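(* Let $H,K$ be Hilbert spaces and $T$ a densely defined closed operator from $D(T)\subset H$ into $K$ with closed range, with polar decomposition $T=U_T|T|$. Then $w(T)|T|$ is closable with $U_T=\overline{w(T)|T|}$, and $w(T)=U_T|w(T)|$ is the polar decomposition of $w(T)$.
   Context: For an operator $A$, $|A|=(A^{*}A)^{1/2}$; $T=U_T|T|$ is the polar decomposition, with $U_T$ the partial isometry with initial space $\overline{R(|T|)}$ and final space $\overline{R(T)}$. For a densely defined closed operator $A$ with closed range, $C(A)=D(A)\cap N(A)^{\perp}$, and the Moore–Penrose inverse $A^{\dagger}$ is defined on $R(A)\oplus^{\perp}R(A)^{\perp}$ by $A^{\dagger}y=(A|_{C(A)})^{-1}y$ for $y\in R(A)$ and $A^{\dagger}y=0$ for $y\in R(A)^{\perp}$. The generalized Cauchy dual is $w(A)=A(A^{*}A)^{\dagger}$ (products on natural domains); $\overline{B}$ is the closure of a closable $B$. *)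

theory Defs
  imports "HOL-Analysis.Analysis"
begin

class chilbert = real_normed_vector + complete_space +
  fixes hscale :: "complex \<Rightarrow> 'a \<Rightarrow> 'a"
    and hinner :: "'a \<Rightarrow> 'a \<Rightarrow> complex"
  assumes hscale_add_right: "hscale c (x + y) = hscale c x + hscale c y"
    and hscale_add_left: "hscale (c + d) x = hscale c x + hscale d x"
    and hscale_hscale: "hscale c (hscale d x) = hscale (c * d) x"
    and hscale_one: "hscale 1 x = x"
    and scaleR_hscale: "scaleR r x = hscale (complex_of_real r) x"
    and hinner_commute: "hinner x y = cnj (hinner y x)"
    and hinner_add_left: "hinner (x + y) z = hinner x z + hinner y z"
    and hinner_hscale_left: "hinner (hscale c x) y = cnj c * hinner x y"
    and hinner_self_norm: "hinner x x = complex_of_real ((norm x)\<^sup>2)"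

text \<open>An operator from H to K is a partial map; its domain is dom A, its range ran A.
Products of operators are taken on their natural domains, i.e. map composition.\<close>

type_synonym ('a, 'b) op = "'a \<Rightarrow> 'b option"

definition csubspace :: "'a::chilbert set \<Rightarrow> bool" where
  "csubspace S \<longleftrightarrow> 0 \<in> S \<and> (\<forall>x\<in>S. \<forall>y\<in>S. x + y \<in> S) \<and> (\<forall>c. \<forall>x\<in>S. hscale c x \<in> S)"

definition lin_op :: "('a::chilbert, 'b::chilbert) op \<Rightarrow> bool" where
  "lin_op A \<longleftrightarrow> csubspace (dom A) \<and>
     (\<forall>x\<in>dom A. \<forall>y\<in>dom A. the (A (x + y)) = the (A x) + the (A y)) \<and>
     (\<forall>c. \<forall>x\<in>dom A. the (A (hscale c x)) = hscale c (the (A x)))"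

definition densely_defined :: "('a::chilbert, 'b::chilbert) op \<Rightarrow> bool" where
  "densely_defined A \<longleftrightarrow> closure (dom A) = UNIV"

definition op_graph :: "('a, 'b) op \<Rightarrow> ('a \<times> 'b) set" where
  "op_graph A = {(x, y). A x = Some y}"

definition closed_op :: "('a::chilbert, 'b::chilbert) op \<Rightarrow> bool" where
  "closed_op A \<longleftrightarrow> lin_op A \<and> closed (op_graph A)"

definition closable :: "('a::chilbert, 'b::chilbert) op \<Rightarrow> bool" where
  "closable A \<longleftrightarrow> lin_op A \<and>
     (\<forall>x y z. (x, y) \<in> closure (op_graph A) \<and> (x, z) \<in> closure (op_graph A) \<longrightarrow> y = z)"

definition op_closure :: "('a::chilbert, 'b::chilbert) op \<Rightarrow> ('a, 'b) op" where
  "op_closure A = (\<lambda>x. if \<exists>y. (x, y) \<in> closure (op_graph A)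
                         then Some (THE y. (x, y) \<in> closure (op_graph A)) else None)"

definition kernel_op :: "('a::chilbert, 'b::chilbert) op \<Rightarrow> 'a set" where
  "kernel_op A = {x. A x = Some 0}"

definition orth :: "'a::chilbert set \<Rightarrow> 'a set" where
  "orth M = {x. \<forall>y\<in>M. hinner y x = 0}"

definition op_adj :: "('a::chilbert, 'b::chilbert) op \<Rightarrow> ('b, 'a) op" where
  "op_adj A = (\<lambda>y. if \<exists>z. \<forall>x\<in>dom A. hinner (the (A x)) y = hinner x z
                   then Some (THE z. \<forall>x\<in>dom A. hinner (the (A x)) y = hinner x z) else None)"

definition selfadjoint :: "('a::chilbert, 'a) op \<Rightarrow> bool" where
  "selfadjoint S \<longleftrightarrow> lin_op S \<and> densely_defined S \<and> op_adj S = S"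

definition positive_op :: "('a::chilbert, 'a) op \<Rightarrow> bool" where
  "positive_op S \<longleftrightarrow> (\<forall>x\<in>dom S. Im (hinner x (the (S x))) = 0 \<and> 0 \<le> Re (hinner x (the (S x))))"

definition op_abs :: "('a::chilbert, 'b::chilbert) op \<Rightarrow> ('a, 'a) op" where
  "op_abs A = (THE S. selfadjoint S \<and> positive_op S \<and> S \<circ>\<^sub>m S = op_adj A \<circ>\<^sub>m A)"

text \<open>U is a partial isometry with initial space M and final space N (M a closed subspace).\<close>
definition partial_isometry :: "('a::chilbert, 'b::chilbert) op \<Rightarrow> 'a set \<Rightarrow> 'b set \<Rightarrow> bool" where
  "partial_isometry U M N \<longleftrightarrow> dom U = UNIV \<and> lin_op U \<and>
     (\<forall>x\<in>M. norm (the (U x)) = norm x) \<and> (\<forall>x\<in>orth M. U x = Some 0) \<and> ran U = N"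

definition polar_decomp :: "('a::chilbert, 'b::chilbert) op \<Rightarrow> ('a, 'b) op \<Rightarrow> bool" where
  "polar_decomp U A \<longleftrightarrow> lin_op A \<and> densely_defined A \<and> closed_op A \<and>
     partial_isometry U (closure (ran (op_abs A))) (closure (ran A)) \<and>
     A = U \<circ>\<^sub>m op_abs A"

text \<open>Moore--Penrose inverse, defined on R(A) \<oplus> R(A)^perp: A^dagger(y1 + y2) = (A|C(A))^(-1) y1.\<close>
definition coimage_dom :: "('a::chilbert, 'b::chilbert) op \<Rightarrow> 'a set" where
  "coimage_dom A = dom A \<inter> orth (kernel_op A)"

definition mp_inv :: "('a::chilbert, 'b::chilbert) op \<Rightarrow> ('b, 'a) op" where
  "mp_inv A = (\<lambda>y. if \<exists>y1 y2. y1 \<in> ran A \<and> y2 \<in> orth (ran A) \<and> y = y1 + y2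
                   then Some (THE x. x \<in> coimage_dom A \<and> (\<exists>y2\<in>orth (ran A). A x = Some (y - y2)))
                   else None)"

definition cdual :: "('a::chilbert, 'b::chilbert) op \<Rightarrow> ('a, 'b) op" where
  "cdual A = A \<circ>\<^sub>m mp_inv (op_adj A \<circ>\<^sub>m A)"

end

theory Submission
  imports Defs
begin

text \<open>Let \<open>N\<close> be the kernel of \<open>T\<close> and \<open>Q\<close> the projection onto \<open>N\<^sup>\<bottom>\<close>.  By the closed graph theorem
  \<open>L = T\<^sup>\<dagger>\<close> is bounded.  With \<open>W = L\<^sup>*\<close> the bounded positive operator \<open>L W\<close> is \<open>(T\<^sup>* T)\<^sup>\<dagger>\<close>, so
  \<open>w(T) = T L W = W\<close>.  Let \<open>R\<close> be the positive square root of \<open>L W = W\<^sup>* W\<close>.  Then \<open>|w(T)| = R\<close> and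
  \<open>|T| = R\<^sup>\<dagger>\<close>; this provides existence and uniqueness of \<open>|T|\<close> without the spectral theorem for
  unbounded operators.  From \<open>T = U |T|\<close> one gets \<open>W = T L W = U R\<^sup>\<dagger> R R = U R\<close>, hence
  \<open>W |T| = U R R\<^sup>\<dagger>\<close> is the restriction of \<open>U\<close> to the dense domain of \<open>|T|\<close>.\<close>

text \<open>\<open>op_abs\<close> is a definite description over partial maps, so the hypothesis on
  \<open>U\<close> yields nothing until a positive selfadjoint root of \<open>TT\<close>, the
  product of the adjoint of \<open>T\<close> with \<open>T\<close>, is known to exist and to be
  unique. Closed range makes this reachable: \<open>TT x = Some u\<close> is equivalent to
  \<open>u\<close> lying in the orthogonal complement \<open>C\<close> of the kernel together with
  \<open>L (W u) = Q x\<close>. Questions about unbounded roots thereby become questions about the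
  bounded product of \<open>L\<close> and \<open>W\<close>, whose root comes from a norm convergent
  iteration. A competing root of \<open>TT\<close> leads to an everywhere defined root of that
  product whose boundedness is not known in advance; symmetry alone gives its linearity and lets
  limits be taken weakly. The same \<open>U\<close> serves both decompositions because the moduli of
  \<open>T\<close> and of \<open>W\<close> have ranges with the common closure \<open>C\<close>, and
  the ranges of \<open>T\<close> and \<open>W\<close> have the common closure
  \<open>ran T\<close>.\<close>

instance chilbert \<subseteq> banach ..

section \<open>Hilbert space geometry\<close>

lemma hinner_add_right: "hinner x (y + z) = hinner x y + hinner x z"
  for x :: "'a::chilbert"
  using hinner_commute[of x "y + z"] hinner_commute[of x y] hinner_commute[of x z]
  by (simp add: hinner_add_left)

lemma hinner_hscale_right: "hinner x (hscale c y) = c * hinner x y"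
  for x :: "'a::chilbert"
  using hinner_commute[of x "hscale c y"] hinner_commute[of x y]
  by (simp add: hinner_hscale_left)

lemma hinner_zero_left [simp]: "hinner 0 x = 0" for x :: "'a::chilbert"
  using hinner_add_left[of 0 0 x] by simp

lemma hinner_zero_right [simp]: "hinner x 0 = 0" for x :: "'a::chilbert"
  using hinner_add_right[of x 0 0] by simp

lemma hinner_minus_left: "hinner (- x) y = - hinner x y" for x :: "'a::chilbert"
  using hinner_add_left[of x "- x" y] by (simp add: add_eq_0_iff)

lemma hinner_minus_right: "hinner x (- y) = - hinner x y" for x :: "'a::chilbert"
  using hinner_add_right[of x y "- y"] by (simp add: add_eq_0_iff)

lemma hinner_diff_left: "hinner (x - y) z = hinner x z - hinner y z" for x :: "'a::chilbert"
  using hinner_add_left[of x "- y" z] by (simp add: hinner_minus_left)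

lemma hinner_diff_right: "hinner x (y - z) = hinner x y - hinner x z" for x :: "'a::chilbert"
  using hinner_add_right[of x y "- z"] by (simp add: hinner_minus_right)

lemma hinner_scaleR_left: "hinner (r *\<^sub>R x) y = r *\<^sub>R hinner x y" for x :: "'a::chilbert"
  by (simp add: scaleR_hscale hinner_hscale_left scaleR_conv_of_real)

lemma hinner_scaleR_right: "hinner x (r *\<^sub>R y) = r *\<^sub>R hinner x y" for x :: "'a::chilbert"
  by (simp add: scaleR_hscale hinner_hscale_right scaleR_conv_of_real)

lemma hinner_self_eq_0 [simp]: "hinner x x = 0 \<longleftrightarrow> x = 0" for x :: "'a::chilbert"
  by (simp add: hinner_self_norm)

lemma hinner_eq_0_commute: "hinner x y = 0 \<longleftrightarrow> hinner y x = 0" for x :: "'a::chilbert"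
  by (metis hinner_commute complex_cnj_zero)

lemma norm_sq_hinner: "(norm x)\<^sup>2 = Re (hinner x x)" for x :: "'a::chilbert"
  by (simp add: hinner_self_norm)

lemma hscale_zero_right [simp]: "hscale c 0 = (0::'a::chilbert)"
  using hscale_add_right[of c 0 0] by simp

lemma hscale_minus_one: "hscale (- 1) x = - x" for x :: "'a::chilbert"
  using scaleR_hscale[of "- 1" x] by simp

lemma hscale_minus_right: "hscale c (- x) = - hscale c x" for x :: "'a::chilbert"
  using hscale_add_right[of c x "- x"] by (simp add: add_eq_0_iff)

lemma hscale_diff_right: "hscale c (x - y) = hscale c x - hscale c y" for x :: "'a::chilbert"
  using hscale_add_right[of c x "- y"] by (simp add: hscale_minus_right)

lemma hscale_scaleR_commute: "hscale c (r *\<^sub>R x) = r *\<^sub>R hscale c x" for x :: "'a::chilbert"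
  by (simp add: scaleR_hscale hscale_hscale mult.commute)

lemma norm_hscale: "norm (hscale c x) = cmod c * norm x" for x :: "'a::chilbert"
proof -
  have "complex_of_real ((norm (hscale c x))\<^sup>2) = cnj c * c * complex_of_real ((norm x)\<^sup>2)"
    by (simp only: hinner_self_norm[symmetric] hinner_hscale_left hinner_hscale_right ac_simps)
  also have "\<dots> = complex_of_real ((cmod c * norm x)\<^sup>2)"
    using complex_norm_square[of c] by (simp add: power_mult_distrib mult.commute)
  finally have "(norm (hscale c x))\<^sup>2 = (cmod c * norm x)\<^sup>2"
    using of_real_eq_iff by blast
  then show ?thesis
    by (simp add: power2_eq_iff_nonneg)
qed

lemma bounded_linear_hscale: "bounded_linear (hscale c :: 'a::chilbert \<Rightarrow> 'a)"
  by (rule bounded_linear_intro[of _ "cmod c"])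
    (simp_all add: hscale_add_right hscale_scaleR_commute norm_hscale mult.commute)

lemma norm_add_sq: "(norm (x + y))\<^sup>2 = (norm x)\<^sup>2 + 2 * Re (hinner x y) + (norm y)\<^sup>2"
  for x :: "'a::chilbert"
  using hinner_commute[of x y]
  by (simp add: norm_sq_hinner hinner_add_left hinner_add_right)

lemma norm_diff_sq: "(norm (x - y))\<^sup>2 = (norm x)\<^sup>2 - 2 * Re (hinner x y) + (norm y)\<^sup>2"
  for x :: "'a::chilbert"
  using norm_add_sq[of x "- y"] by (simp add: hinner_minus_right)

lemma hinner_cauchy_schwarz: "cmod (hinner x y) \<le> norm x * norm y" for x :: "'a::chilbert"
proof (cases "y = 0")
  case False
  \<comment> \<open>\<open>hscale c y\<close> is the projection of \<open>x\<close> onto the line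
    through \<open>y\<close>; the inner product is linear in its second argument, hence
    \<open>hinner y x\<close> in the numerator.\<close>
  define c where "c = hinner y x / complex_of_real ((norm y)\<^sup>2)"
  have 1: "hinner y (x - hscale c y) = 0"
    using False by (simp add: hinner_diff_right hinner_hscale_right c_def hinner_self_norm)
  have "hinner (hscale c y) (x - hscale c y) = 0"
    using 1 by (simp add: hinner_hscale_left)
  then have "(norm x)\<^sup>2 = (norm (hscale c y))\<^sup>2 + (norm (x - hscale c y))\<^sup>2"
    using norm_add_sq[of "hscale c y" "x - hscale c y"] by simp
  then have "(norm (hscale c y))\<^sup>2 \<le> (norm x)\<^sup>2"
    by simp
  then have "norm (hscale c y) \<le> norm x"
    using power2_le_imp_le norm_ge_zero by blast
  moreover have "norm (hscale c y) = cmod (hinner y x) / norm y"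
    using False by (simp add: norm_hscale c_def norm_divide power2_eq_square norm_mult)
  ultimately have "cmod (hinner y x) \<le> norm x * norm y"
    using False by (simp add: divide_le_eq)
  then show ?thesis
    using hinner_commute[of x y] by simp
qed simp

lemma bounded_bilinear_hinner: "bounded_bilinear (hinner :: 'a::chilbert \<Rightarrow> 'a \<Rightarrow> complex)"
proof
  show "\<exists>K. \<forall>a b::'a. norm (hinner a b) \<le> norm a * norm b * K"
    by (rule exI[of _ 1]) (simp add: hinner_cauchy_schwarz)
qed (simp_all add: hinner_add_left hinner_add_right hinner_scaleR_left hinner_scaleR_right)

lemmas tendsto_hinner = bounded_bilinear.tendsto[OF bounded_bilinear_hinner]

lemma hinner_ext: "(\<And>z. hinner z x = hinner z y) \<Longrightarrow> x = y" for x :: "'a::chilbert"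
proof -
  assume "\<And>z. hinner z x = hinner z y"
  then have "hinner (x - y) (x - y) = 0"
    by (simp add: hinner_diff_right)
  then show ?thesis by simp
qed

section \<open>Complex subspaces, orthogonal complements and the projection theorem\<close>

lemma csubspace_zero: "csubspace S \<Longrightarrow> 0 \<in> S"
  and csubspace_add: "csubspace S \<Longrightarrow> x \<in> S \<Longrightarrow> y \<in> S \<Longrightarrow> x + y \<in> S"
  and csubspace_hscale: "csubspace S \<Longrightarrow> x \<in> S \<Longrightarrow> hscale c x \<in> S"
  by (auto simp: csubspace_def)

lemma csubspace_scaleR: "csubspace S \<Longrightarrow> x \<in> S \<Longrightarrow> r *\<^sub>R x \<in> S"
  by (simp add: scaleR_hscale csubspace_hscale)

lemma csubspace_diff: "csubspace S \<Longrightarrow> x \<in> S \<Longrightarrow> y \<in> S \<Longrightarrow> x - y \<in> S"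
  using csubspace_add[of S x "- y"] csubspace_hscale[of S y "- 1"]
  by (simp add: hscale_minus_one)

lemma csubspace_orth: "csubspace (orth M)"
  by (auto simp: csubspace_def orth_def hinner_add_right hinner_hscale_right)

lemma closed_orth: "closed (orth M)"
proof (unfold closed_sequential_limits, intro allI impI)
  fix f l assume f: "(\<forall>n. f n \<in> orth M) \<and> f \<longlonglongrightarrow> l"
  show "l \<in> orth M"
    unfolding orth_def
  proof (clarify)
    fix y assume "y \<in> M"
    then have "(\<lambda>n. hinner y (f n)) = (\<lambda>n. 0)"
      using f by (auto simp: orth_def)
    moreover have "(\<lambda>n. hinner y (f n)) \<longlonglongrightarrow> hinner y l"
      using f by (intro tendsto_hinner tendsto_const) auto
    ultimately show "hinner y l = 0"
      by (metis LIMSEQ_unique tendsto_const)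
  qed
qed

lemma csubspace_closure:
  assumes "csubspace S"
  shows "csubspace (closure S)"
  unfolding csubspace_def
proof (intro conjI ballI allI)
  show "0 \<in> closure S"
    using assms closure_subset csubspace_zero by blast
next
  fix x y assume "x \<in> closure S" "y \<in> closure S"
  then obtain f g where "\<And>n. f n \<in> S" "f \<longlonglongrightarrow> x" "\<And>n. g n \<in> S" "g \<longlonglongrightarrow> y"
    by (meson closure_sequential)
  then have "\<forall>n. f n + g n \<in> S" "(\<lambda>n. f n + g n) \<longlonglongrightarrow> x + y"
    using assms by (auto intro: csubspace_add tendsto_add)
  then show "x + y \<in> closure S"
    by (auto simp: closure_sequential)
next
  fix c x assume "x \<in> closure S"
  then obtain f where "\<And>n. f n \<in> S" "f \<longlonglongrightarrow> x"
    by (meson closure_sequential)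
  then have "\<forall>n. hscale c (f n) \<in> S" "(\<lambda>n. hscale c (f n)) \<longlonglongrightarrow> hscale c x"
    using assms by (auto intro: csubspace_hscale bounded_linear.tendsto[OF bounded_linear_hscale])
  then show "hscale c x \<in> closure S"
    by (auto simp: closure_sequential)
qed

text \<open>A minimizing sequence for the distance to \<open>M\<close> is Cauchy by the
  parallelogram law. Its limit \<open>p\<close> leaves an orthogonal remainder, since otherwise a
  suitable multiple of some \<open>y\<close> in \<open>M\<close> would shorten
  \<open>x - p\<close>.\<close>

lemma orthogonal_decomposition:
  fixes M :: "'a::chilbert set"
  assumes M: "csubspace M" "closed M"
  shows "\<exists>p. p \<in> M \<and> x - p \<in> orth M"
proof -
  define d where "d = infdist x M"
  have ne: "M \<noteq> {}" using M(1) csubspace_zero by blast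
  have d_le: "d \<le> norm (x - m)" if "m \<in> M" for m
    using infdist_le[OF that] by (simp add: d_def dist_norm)
  have d0: "d \<ge> 0" by (simp add: d_def infdist_nonneg)
  have "\<exists>m\<in>M. norm (x - m) < d + 1 / Suc n" for n
  proof (rule ccontr)
    assume "\<not> ?thesis"
    then have "d + 1 / Suc n \<le> dist x m" if "m \<in> M" for m
      using that by (force simp: dist_norm)
    then have "d + 1 / Suc n \<le> infdist x M"
      using ne by (auto simp: infdist_def intro!: cINF_greatest)
    then have "1 / real (Suc n) \<le> 0"
      by (simp add: d_def)
    then show False
      by (simp add: field_simps)
  qed
  then obtain f where f: "\<And>n. f n \<in> M" "\<And>n. norm (x - f n) < d + 1 / Suc n"
    by metis
  \<comment> \<open>\<open>e n\<close> is the slack of the squared distance over its infimum, the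
    quantity that the parallelogram law controls.\<close>
  define e where "e n = (d + 1 / Suc n)\<^sup>2 - d\<^sup>2" for n
  have e: "(norm (x - f n))\<^sup>2 \<le> d\<^sup>2 + e n" for n
    unfolding e_def using f(2)[of n] by (simp add: power_mono less_imp_le)
  have e_lim: "e \<longlonglongrightarrow> 0"
  proof -
    have "e \<longlonglongrightarrow> (d + 0)\<^sup>2 - d\<^sup>2"
      unfolding e_def using LIMSEQ_inverse_real_of_nat
      by (intro tendsto_intros) (simp add: inverse_eq_divide)
    then show ?thesis by simp
  qed
  have par: "(norm (f m - f n))\<^sup>2 \<le> 2 * e m + 2 * e n" for m n
  proof -
    let ?u = "x - f m" and ?v = "x - f n"
    \<comment> \<open>The midpoint stays in \<open>M\<close>, hence at distance at least
      \<open>d\<close> from \<open>x\<close>; this bounds the sum term of the parallelogram law from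
      below.\<close>
    have mid: "(1/2) *\<^sub>R (f m + f n) \<in> M"
      using f M by (intro csubspace_scaleR csubspace_add)
    have "?u + ?v = 2 *\<^sub>R (x - (1/2) *\<^sub>R (f m + f n))"
      by (simp add: algebra_simps scaleR_2)
    then have "norm (?u + ?v) \<ge> 2 * d"
      using d_le[OF mid] by simp
    then have "(norm (?u + ?v))\<^sup>2 \<ge> (2 * d)\<^sup>2"
      using d0 by (intro power_mono) auto
    moreover have "(norm (?u + ?v))\<^sup>2 + (norm (?u - ?v))\<^sup>2 = 2 * (norm ?u)\<^sup>2 + 2 * (norm ?v)\<^sup>2"
      by (simp only: norm_add_sq norm_diff_sq) simp
    moreover have "norm (?u - ?v) = norm (f m - f n)"
      by (simp add: norm_minus_commute)
    ultimately show ?thesis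
      using e[of m] e[of n] by (simp add: power_mult_distrib)
  qed
  have "Cauchy f"
  proof (rule metric_CauchyI)
    fix r :: real assume r: "r > 0"
    then have "\<forall>\<^sub>F n in sequentially. e n < r\<^sup>2 / 4"
      by (intro order_tendstoD(2)[OF e_lim]) simp
    then obtain N where N: "\<And>n. n \<ge> N \<Longrightarrow> e n < r\<^sup>2 / 4"
      by (auto simp: eventually_sequentially)
    show "\<exists>N. \<forall>m\<ge>N. \<forall>n\<ge>N. dist (f m) (f n) < r"
    proof (intro exI[of _ N] allI impI)
      fix m n assume "m \<ge> N" "n \<ge> N"
      then have "(norm (f m - f n))\<^sup>2 < r\<^sup>2"
        using par[of m n] N[of m] N[of n] by linarith
      then show "dist (f m) (f n) < r"
        using r by (simp add: dist_norm power_less_imp_less_base)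
    qed
  qed
  then obtain p where p: "f \<longlonglongrightarrow> p"
    using Cauchy_convergent convergent_def by blast
  have pM: "p \<in> M"
    using M(2) f(1) p closed_sequentially by blast
  have "(\<lambda>n. (norm (x - f n))\<^sup>2) \<longlonglongrightarrow> (norm (x - p))\<^sup>2"
    using p by (intro tendsto_intros)
  moreover have "(\<lambda>n. d\<^sup>2 + e n) \<longlonglongrightarrow> d\<^sup>2 + 0"
    using e_lim by (intro tendsto_intros)
  ultimately have "(norm (x - p))\<^sup>2 \<le> d\<^sup>2"
    using e LIMSEQ_le by fastforce
  moreover have "d\<^sup>2 \<le> (norm (x - (p + m)))\<^sup>2" if "m \<in> M" for m
    using d_le[of "p + m"] d0 pM M(1) that by (intro power_mono) (auto intro: csubspace_add)
  ultimately have min: "(norm (x - p))\<^sup>2 \<le> (norm (x - p - m))\<^sup>2" if "m \<in> M" for m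
    using that order_trans by (metis diff_diff_eq)
  have "hinner y (x - p) = 0" if y: "y \<in> M" for y
  proof (rule ccontr)
    assume nz: "hinner y (x - p) \<noteq> 0"
    then have y0: "y \<noteq> 0" by auto
    define c where "c = hinner y (x - p) / complex_of_real ((norm y)\<^sup>2)"
    have "hinner y (x - p - hscale c y) = 0"
      using y0 by (simp add: hinner_diff_right[of y "x - p"] hinner_hscale_right c_def hinner_self_norm)
    then have "hinner (hscale c y) (x - p - hscale c y) = 0"
      by (simp add: hinner_hscale_left)
    then have "(norm (x - p))\<^sup>2 = (norm (hscale c y))\<^sup>2 + (norm (x - p - hscale c y))\<^sup>2"
      using norm_add_sq[of "hscale c y" "x - p - hscale c y"] by simp
    moreover have "norm (hscale c y) > 0"
      using y0 nz by (simp add: norm_hscale c_def)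
    ultimately show False
      using min[OF csubspace_hscale[OF M(1) y, of c]] by (simp add: not_le[symmetric])
  qed
  then show ?thesis
    using pM by (auto simp: orth_def)
qed

lemma subset_orth_orth: "M \<subseteq> orth (orth M)"
  by (auto simp: orth_def) (metis hinner_eq_0_commute)

lemma orth_antimono: "A \<subseteq> B \<Longrightarrow> orth B \<subseteq> orth A"
  by (auto simp: orth_def)

lemma orth_Int_self: "x \<in> M \<Longrightarrow> x \<in> orth M \<Longrightarrow> x = 0" for x :: "'a::chilbert"
  by (auto simp: orth_def)

text \<open>Projecting a point of the double complement onto \<open>closure M\<close> leaves a
  remainder that lies in \<open>orth M\<close> and in \<open>orth (orth M)\<close>, hence is
  zero.\<close>

lemma orth_orth_eq_closure:
  assumes "csubspace M"
  shows "orth (orth M) = closure M"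
proof
  show "closure M \<subseteq> orth (orth M)"
    by (simp add: closure_minimal closed_orth subset_orth_orth)
  show "orth (orth M) \<subseteq> closure M"
  proof
    fix x assume x: "x \<in> orth (orth M)"
    obtain p where p: "p \<in> closure M" "x - p \<in> orth (closure M)"
      using orthogonal_decomposition[of "closure M" x] assms csubspace_closure by blast
    have "x - p \<in> orth M"
      using p(2) orth_antimono[OF closure_subset] by blast
    moreover have "x - p \<in> orth (orth M)"
      using x p(1) \<open>closure M \<subseteq> orth (orth M)\<close> by (blast intro: csubspace_diff csubspace_orth)
    ultimately have "x = p"
      using orth_Int_self by fastforce
    then show "x \<in> closure M" using p by simp
  qed
qed

lemma dense_if_orth_trivial:
  assumes "csubspace M" "orth M \<subseteq> {0}"
  shows "closure M = UNIV"
proof -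
  have "orth (orth M) = UNIV"
    using assms(2) by (auto simp: orth_def)
  then show ?thesis
    using orth_orth_eq_closure[OF assms(1)] by simp
qed

lemma orth_dense:
  assumes "closure M = UNIV"
  shows "orth M = {0}"
proof -
  have "x = 0" if "x \<in> orth M" for x
  proof -
    have "M \<subseteq> orth {x}"
      using that by (auto simp: orth_def) (metis hinner_eq_0_commute)
    then have "closure M \<subseteq> orth {x}"
      by (simp add: closure_minimal closed_orth)
    then have "x \<in> orth {x}" using assms by auto
    then show ?thesis using orth_Int_self by blast
  qed
  then show ?thesis by (auto simp: orth_def)
qed

section \<open>Orthogonal projections\<close>

definition oproj :: "'a::chilbert set \<Rightarrow> 'a \<Rightarrow> 'a" where
  "oproj M x = (SOME p. p \<in> M \<and> x - p \<in> orth M)"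

context
  fixes M :: "'a::chilbert set"
  assumes M: "csubspace M" "closed M"
begin

lemma oproj_in: "oproj M x \<in> M"
  and oproj_diff: "x - oproj M x \<in> orth M"
  using someI_ex[OF orthogonal_decomposition[OF M, of x]] by (auto simp: oproj_def)

lemma oproj_unique:
  assumes "p \<in> M" "x - p \<in> orth M"
  shows "oproj M x = p"
proof -
  have "oproj M x - p \<in> M"
    using oproj_in assms M(1) by (blast intro: csubspace_diff)
  moreover have "(x - p) - (x - oproj M x) \<in> orth M"
    using oproj_diff assms by (blast intro: csubspace_diff csubspace_orth)
  ultimately show ?thesis
    using orth_Int_self[of "oproj M x - p"] by simp
qed

lemma oproj_ident: "x \<in> M \<Longrightarrow> oproj M x = x"
  by (rule oproj_unique) (simp_all add: csubspace_zero csubspace_orth)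

lemma oproj_orth: "x \<in> orth M \<Longrightarrow> oproj M x = 0"
  by (rule oproj_unique) (simp_all add: csubspace_zero M)

lemma oproj_add: "oproj M (x + y) = oproj M x + oproj M y"
  using csubspace_add[OF csubspace_orth oproj_diff oproj_diff, of x y]
  by (intro oproj_unique) (simp_all add: csubspace_add M oproj_in algebra_simps)

lemma oproj_hscale: "oproj M (hscale c x) = hscale c (oproj M x)"
  using csubspace_hscale[OF csubspace_orth oproj_diff, of c x]
  by (intro oproj_unique) (simp_all add: csubspace_hscale M oproj_in hscale_diff_right)

lemma hinner_oproj_left: "y \<in> M \<Longrightarrow> hinner (oproj M x) y = hinner x y"
  using oproj_diff[of x] hinner_eq_0_commute[of "x - oproj M x" y]
  by (auto simp: orth_def hinner_diff_left)

lemma hinner_oproj_right: "y \<in> M \<Longrightarrow> hinner y (oproj M x) = hinner y x"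
  using oproj_diff[of x] by (auto simp: orth_def hinner_diff_right)

lemma norm_oproj_le: "norm (oproj M x) \<le> norm x"
proof -
  have "hinner (oproj M x) (x - oproj M x) = 0"
    using oproj_diff[of x] oproj_in[of x] by (auto simp: orth_def)
  then have "(norm x)\<^sup>2 = (norm (oproj M x))\<^sup>2 + (norm (x - oproj M x))\<^sup>2"
    using norm_add_sq[of "oproj M x" "x - oproj M x"] by simp
  then have "(norm (oproj M x))\<^sup>2 \<le> (norm x)\<^sup>2" by simp
  then show ?thesis
    using power2_le_imp_le norm_ge_zero by blast
qed

lemma bounded_linear_oproj: "bounded_linear (oproj M)"
  by (rule bounded_linear_intro[of _ 1])
    (simp_all add: oproj_add oproj_hscale scaleR_hscale norm_oproj_le)

end

section \<open>The closed graph theorem\<close>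

lemma Baire_union_interior:
  fixes F :: "nat \<Rightarrow> 'a::complete_space set"
  assumes "\<And>n. closed (F n)" "(\<Union>n. F n) = UNIV"
  shows "\<exists>n. interior (F n) \<noteq> {}"
proof (rule ccontr)
  assume "\<not> ?thesis"
  then have "Met_TC.mtopology interior_of \<Union>(range F) = {}"
    using assms(1) by (intro Met_TC.metric_Baire_category_alt)
      (auto simp: complete_UNIV)
  then show False
    using assms(2) by simp
qed

text \<open>A pure Baire argument, with no assumption on the graph: some sublevel set of
  \<open>norm (f x)\<close> is dense in a ball, differences of its elements approximate every point
  of a ball about 0, and homogeneity spreads the estimate to all \<open>x\<close>.\<close>

lemma closed_graph_approx:
  fixes f :: "'a::banach \<Rightarrow> 'b::real_normed_vector"
  assumes f: "linear f"
  shows "\<exists>C\<ge>0. \<forall>x. \<exists>y. norm (x - y) \<le> norm x / 2 \<and> norm (f y) \<le> C * norm x"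
proof -
  define E where "E n = {x. norm (f x) \<le> real n}" for n
  have "(\<Union>n. closure (E n)) = UNIV"
  proof -
    have "x \<in> (\<Union>n. closure (E n))" for x
    proof -
      obtain n where "norm (f x) \<le> real n"
        using real_arch_simple[of "norm (f x)"] by blast
      then have "x \<in> E n"
        by (simp add: E_def)
      then show ?thesis
        using closure_subset[of "E n"] by blast
    qed
    then show ?thesis by blast
  qed
  then obtain n where "interior (closure (E n)) \<noteq> {}"
    using Baire_union_interior[of "\<lambda>n. closure (E n)"] by auto
  then obtain a r where r: "r > 0" "ball a r \<subseteq> closure (E n)"
    by (metis all_not_in_conv mem_interior)
  have near: "\<exists>y. norm (x - y) < e \<and> norm (f y) \<le> 2 * real n"
    if x: "norm x < r" and e: "e > 0" for x e
  proof -
    have "a + x \<in> closure (E n)" "a \<in> closure (E n)"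
      using r x by (auto simp: dist_norm subset_iff)
    then obtain u v where uv: "u \<in> E n" "norm (u - (a + x)) < e / 2" "v \<in> E n" "norm (v - a) < e / 2"
      using e unfolding closure_approachable dist_norm by (meson half_gt_zero)
    have "norm (x - (u - v)) = norm ((v - a) - (u - (a + x)))"
      by (simp add: algebra_simps)
    also have "\<dots> < e"
      using uv norm_triangle_ineq4[of "v - a" "u - (a + x)"] by linarith
    finally have "norm (x - (u - v)) < e" .
    moreover have "norm (f (u - v)) \<le> 2 * real n"
      using uv norm_triangle_ineq4[of "f u" "f v"] by (simp add: E_def linear_diff[OF f])
    ultimately show ?thesis by blast
  qed
  show ?thesis
  proof (intro exI[of _ "4 * real n / r"] conjI allI)
    show "4 * real n / r \<ge> 0" using r by simp
    fix x :: 'a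
    show "\<exists>y. norm (x - y) \<le> norm x / 2 \<and> norm (f y) \<le> 4 * real n / r * norm x"
    proof (cases "x = 0")
      case True
      then show ?thesis by (intro exI[of _ 0]) (simp add: linear_0[OF f])
    next
      case False
      \<comment> \<open>The scaling brings \<open>x\<close> to norm \<open>r / 2\<close>, inside the
        ball; the tolerance \<open>r / 4\<close> scales back to \<open>norm x / 2\<close>, and
        \<open>2 * real n\<close> to \<open>4 * real n / r * norm x\<close>.\<close>
      define t where "t = r / (2 * norm x)"
      have t: "t > 0" using r False by (simp add: t_def)
      have "norm (t *\<^sub>R x) = r / 2"
        using r False by (simp add: t_def)
      then have "norm (t *\<^sub>R x) < r" using r by simp
      from near[OF this, of "r / 4"] r obtain y
        where y: "norm (t *\<^sub>R x - y) < r / 4" "norm (f y) \<le> 2 * real n"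
        by auto
      have "x - (1 / t) *\<^sub>R y = (1 / t) *\<^sub>R (t *\<^sub>R x - y)"
        using t by (simp add: algebra_simps)
      then have "norm (x - (1 / t) *\<^sub>R y) = (1 / t) * norm (t *\<^sub>R x - y)"
        using t by simp
      also have "\<dots> \<le> (1 / t) * (r / 4)"
        using y t by (intro mult_left_mono) auto
      also have "\<dots> = norm x / 2"
        using r False by (simp add: t_def)
      finally have 1: "norm (x - (1 / t) *\<^sub>R y) \<le> norm x / 2" .
      have "norm (f ((1 / t) *\<^sub>R y)) = (1 / t) * norm (f y)"
        using t by (simp add: linear_scale[OF f])
      also have "\<dots> \<le> (1 / t) * (2 * real n)"
        using y t by (intro mult_left_mono) auto
      also have "\<dots> = 4 * real n / r * norm x"
        using r False by (simp add: t_def)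
      finally show ?thesis using 1 by blast
    qed
  qed
qed

text \<open>Iterated approximation expands \<open>x\<close> into a series whose images are dominated
  by a geometric series with sum \<open>C * norm x * 2\<close>. The closed graph identifies the sum
  of the images with \<open>f x\<close>.\<close>

lemma closed_graph_bounded_linear:
  fixes f :: "'a::banach \<Rightarrow> 'b::banach"
  assumes f: "linear f"
    and cl: "\<And>u x y. u \<longlonglongrightarrow> x \<Longrightarrow> (\<lambda>n. f (u n)) \<longlonglongrightarrow> y \<Longrightarrow> f x = y"
  shows "bounded_linear f"
proof -
  obtain C g where C: "C \<ge> 0"
    and g: "\<And>x. norm (x - g x) \<le> norm x / 2" "\<And>x. norm (f (g x)) \<le> C * norm x"
    using closed_graph_approx[OF f] by metis
  have "norm (f x) \<le> norm x * (2 * C)" for x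
  proof -
    \<comment> \<open>\<open>r k\<close> is what remains of \<open>x\<close> after \<open>k\<close>
      approximations; each one at least halves the norm.\<close>
    define r where "r k = ((\<lambda>x. x - g x) ^^ k) x" for k
    have r: "norm (r k) \<le> norm x * (1 / 2) ^ k" for k
    proof (induction k)
      case (Suc k)
      then show ?case using g(1)[of "r k"] by (simp add: r_def)
    qed (simp add: r_def)
    have partial: "(\<Sum>k<n. g (r k)) = x - r n" for n
      by (induction n) (simp_all add: r_def)
    have "(\<lambda>k. norm x * (1 / 2) ^ k) \<longlonglongrightarrow> norm x * 0"
      by (intro tendsto_mult tendsto_const LIMSEQ_power_zero) simp
    then have "r \<longlonglongrightarrow> 0"
      using r by (intro Lim_null_comparison[of r]) auto
    then have lim: "(\<lambda>n. \<Sum>k<n. g (r k)) \<longlonglongrightarrow> x"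
      unfolding partial using tendsto_diff[OF tendsto_const, of r 0 sequentially x] by simp
    have bound: "norm (f (g (r k))) \<le> C * norm x * (1 / 2) ^ k" for k
      using g(2)[of "r k"] mult_left_mono[OF r C, of k] by (simp add: mult.assoc)
    have geo: "(\<lambda>k. C * norm x * (1 / 2) ^ k) sums (C * norm x * 2)"
      using sums_mult[OF geometric_sums[of "1 / 2 :: real"]] by simp
    have smn: "summable (\<lambda>k. norm (f (g (r k))))"
      using bound by (intro summable_comparison_test'[OF sums_summable[OF geo], of 0]) simp
    then have "(\<lambda>k. f (g (r k))) sums (\<Sum>k. f (g (r k)))"
      by (rule summable_sums[OF summable_norm_cancel])
    then have "(\<lambda>n. f (\<Sum>k<n. g (r k))) \<longlonglongrightarrow> (\<Sum>k. f (g (r k)))"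
      by (simp add: sums_def linear_sum[OF f])
    then have "f x = (\<Sum>k. f (g (r k)))"
      using cl[OF lim] by simp
    also have "norm \<dots> \<le> (\<Sum>k. norm (f (g (r k))))"
      by (rule summable_norm[OF smn])
    also have "\<dots> \<le> (\<Sum>k. C * norm x * (1 / 2) ^ k)"
      using bound smn sums_summable[OF geo] by (rule suminf_le)
    also have "\<dots> = C * norm x * 2"
      using geo sums_unique by metis
    finally show ?thesis by (simp add: ac_simps)
  qed
  then show ?thesis
    using f by (intro bounded_linear_intro[of f "2 * C"]) (auto simp: linear_add linear_scale)
qed

section \<open>Bounded operators and adjoints\<close>

definition clinear :: "('a::chilbert \<Rightarrow> 'b::chilbert) \<Rightarrow> bool" where
  "clinear f \<longleftrightarrow> (\<forall>x y. f (x + y) = f x + f y) \<and> (\<forall>c x. f (hscale c x) = hscale c (f x))"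

lemma clinear_add: "clinear f \<Longrightarrow> f (x + y) = f x + f y"
  and clinear_hscale: "clinear f \<Longrightarrow> f (hscale c x) = hscale c (f x)"
  by (auto simp: clinear_def)

lemma clinear_imp_linear: "clinear f \<Longrightarrow> linear f"
  by (rule linearI) (auto simp: clinear_def scaleR_hscale)

text \<open>Riesz representation of the antilinear functional \<open>f\<close>: unless it vanishes,
  the representing vector is a multiple of some \<open>w\<close> orthogonal to its closed kernel
  \<open>M\<close>.\<close>

lemma bounded_adjoint_exists:
  fixes L :: "'a::chilbert \<Rightarrow> 'b::chilbert"
  assumes L: "clinear L" "bounded_linear L"
  shows "\<exists>z. \<forall>y. hinner (L y) x = hinner y z"
proof -
  interpret L: bounded_linear L by fact
  define f where "f y = hinner (L y) x" for y
  have f_scale: "f (hscale c y) = cnj c * f y" for c y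
    using L by (simp add: f_def clinear_hscale hinner_hscale_left)
  have f_diff: "f (y - z) = f y - f z" for y z
    by (simp add: f_def L.diff hinner_diff_left)
  define M where "M = {y. f y = 0}"
  have M: "csubspace M"
    using L by (auto simp: csubspace_def M_def f_scale) (simp_all add: f_def L.zero L.add hinner_add_left)
  have "closed M"
    unfolding M_def f_def
  proof (rule closed_Collect_eq)
    show "continuous_on UNIV (\<lambda>y. hinner (L y) x)"
      by (rule bounded_bilinear.continuous_on[OF bounded_bilinear_hinner])
        (auto intro: L.continuous_on)
  qed auto
  show ?thesis
  proof (cases "M = UNIV")
    case True
    then show ?thesis by (auto simp: M_def f_def intro!: exI[of _ 0])
  next
    case False
    then obtain y0 where y0: "y0 \<notin> M" by blast
    obtain p where p: "p \<in> M" "y0 - p \<in> orth M"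
      using orthogonal_decomposition[OF M \<open>closed M\<close>] by blast
    define w where "w = y0 - p"
    have fw: "f w \<noteq> 0"
      using y0 p by (simp add: w_def f_diff M_def)
    then have w0: "w \<noteq> 0" by (auto simp: f_def L.zero)
    have "f y = hinner y (hscale (f w / complex_of_real ((norm w)\<^sup>2)) w)" for y
    proof -
      \<comment> \<open>The conjugate compensates the antilinearity of \<open>f\<close>, so that
        \<open>f\<close> vanishes at the difference.\<close>
      have "y - hscale (cnj (f y / f w)) w \<in> M"
        using fw by (simp add: M_def f_diff f_scale)
      then have "hinner (y - hscale (cnj (f y / f w)) w) w = 0"
        using p by (auto simp: w_def orth_def)
      then have "hinner y w = (f y / f w) * complex_of_real ((norm w)\<^sup>2)"
        by (simp add: hinner_diff_left hinner_hscale_left hinner_self_norm)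
      then show ?thesis
        using fw w0 by (simp add: hinner_hscale_right)
    qed
    then have "\<exists>z. \<forall>y. f y = hinner y z"
      by (intro exI allI)
    then show ?thesis
      by (simp only: f_def)
  qed
qed

lemma bounded_adjoint:
  fixes L :: "'a::chilbert \<Rightarrow> 'b::chilbert"
  assumes L: "clinear L" "bounded_linear L"
  obtains Ls where "clinear Ls" "bounded_linear Ls" "\<And>x y. hinner (L y) x = hinner y (Ls x)"
proof -
  obtain Ls where adj: "\<And>x y. hinner (L y) x = hinner y (Ls x)"
    using bounded_adjoint_exists[OF L] by metis
  have lin: "clinear Ls"
    unfolding clinear_def
  proof (intro conjI allI)
    fix x y show "Ls (x + y) = Ls x + Ls y"
      by (rule hinner_ext) (simp flip: adj add: hinner_add_right)
  next
    fix c x show "Ls (hscale c x) = hscale c (Ls x)"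
      by (rule hinner_ext) (simp flip: adj add: hinner_hscale_right)
  qed
  obtain K where K0: "K \<ge> 0" and K: "\<And>y. norm (L y) \<le> norm y * K"
    using bounded_linear.nonneg_bounded[OF L(2)] by blast
  have "norm (Ls x) \<le> norm x * K" for x
  proof (cases "Ls x = 0")
    case True
    then show ?thesis using K0 by simp
  next
    case False
    have "(norm (Ls x))\<^sup>2 = cmod (hinner (L (Ls x)) x)"
      by (simp add: adj hinner_self_norm norm_power)
    also have "\<dots> \<le> norm (L (Ls x)) * norm x"
      by (rule hinner_cauchy_schwarz)
    also have "\<dots> \<le> norm (Ls x) * K * norm x"
      by (intro mult_right_mono K) simp
    finally show ?thesis
      using False by (simp add: power2_eq_square ac_simps)
  qed
  then have "bounded_linear Ls"
    using clinear_imp_linear[OF lin]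
    by (intro bounded_linear_intro[of _ K]) (auto simp: linear_add linear_scale)
  then show ?thesis using that lin adj by blast
qed

section \<open>Square roots of bounded positive operators\<close>

definition hsymmetric :: "('a::chilbert \<Rightarrow> 'a) \<Rightarrow> bool" where
  "hsymmetric f \<longleftrightarrow> (\<forall>x y. hinner (f x) y = hinner x (f y))"

definition hpositive :: "('a::chilbert \<Rightarrow> 'a) \<Rightarrow> bool" where
  "hpositive f \<longleftrightarrow> (\<forall>x. 0 \<le> Re (hinner x (f x)))"

lemma hsymmetricD: "hsymmetric f \<Longrightarrow> hinner (f x) y = hinner x (f y)"
  by (simp add: hsymmetric_def)

lemma hpositiveD: "hpositive f \<Longrightarrow> 0 \<le> Re (hinner x (f x))"
  by (simp add: hpositive_def)

lemma hsymmetric_Im: "hsymmetric f \<Longrightarrow> Im (hinner x (f x)) = 0"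
  using hinner_commute[of x "f x"] by (simp add: hsymmetricD complex_eq_iff)

text \<open>Moving \<open>f\<close> to the other factor turns linearity of \<open>f\<close> into
  that of the inner product. Competing square roots therefore need not be assumed linear.\<close>

lemma hsymmetric_clinear:
  assumes "hsymmetric f"
  shows "clinear f"
  unfolding clinear_def
proof (intro conjI allI)
  fix x y show "f (x + y) = f x + f y"
    by (rule hinner_ext) (simp add: hinner_add_right flip: hsymmetricD[OF assms])
next
  fix c x show "f (hscale c x) = hscale c (f x)"
    by (rule hinner_ext) (simp add: hinner_hscale_right flip: hsymmetricD[OF assms])
qed

text \<open>Along \<open>y + t *\<^sub>R f y\<close> the nonnegative form is a quadratic polynomial
  in \<open>t\<close> without constant term, so its linear coefficient \<open>2 * a\<close> must
  vanish.\<close>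

lemma hpositive_eq_0:
  assumes f: "hsymmetric f" "hpositive f" and 0: "Re (hinner y (f y)) = 0"
  shows "f y = 0"
proof -
  interpret f: linear f
    using f(1) hsymmetric_clinear clinear_imp_linear by blast
  define a where "a = (norm (f y))\<^sup>2"
  define K where "K = Re (hinner (f y) (f (f y)))"
  have K: "K \<ge> 0" using f by (simp add: K_def hpositiveD)
  have quad: "0 \<le> 2 * t * a + t\<^sup>2 * K" for t :: real
  proof -
    have "hinner y (f (f y)) = hinner (f y) (f y)"
      by (simp add: hsymmetricD[OF f(1)])
    then have "Re (hinner (y + t *\<^sub>R f y) (f (y + t *\<^sub>R f y))) = 2 * t * a + t\<^sup>2 * K"
      using 0 by (simp add: f.add f.scale hinner_add_left hinner_add_right hinner_scaleR_left
          hinner_scaleR_right a_def K_def hinner_self_norm power2_eq_square algebra_simps)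
    then show ?thesis
      using f(2) hpositiveD by metis
  qed
  \<comment> \<open>Any positive \<open>s\<close> with \<open>s * K < 2\<close> makes the quadratic
    negative at \<open>t = - (s * a)\<close> unless \<open>a = 0\<close>; adding 1 to
    \<open>K\<close> covers \<open>K = 0\<close>.\<close>
  define s where "s = 1 / (K + 1)"
  have s: "s > 0" "s * K < 2"
    using K by (auto simp: s_def field_simps)
  have "0 \<le> s * a\<^sup>2 * (s * K - 2)"
    using quad[of "- (s * a)"] by (simp add: power2_eq_square algebra_simps)
  then have "s * a\<^sup>2 \<le> 0"
    using s by (simp add: zero_le_mult_iff)
  then have "a = 0"
    using s by (simp add: mult_le_0_iff)
  then show ?thesis by (simp add: a_def)
qed

text \<open>The increments of the operator iteration \<open>X \<mapsto> (A + X\<^sup>2) / 2\<close> for a contraction \<open>A\<close> are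
  dominated in norm by those of the scalar iteration for \<open>A = 1\<close>.  Its limit satisfies
  \<open>(1 - X)\<^sup>2 = 1 - A\<close>.\<close>

fun sqrt_iter :: "('a::real_normed_vector \<Rightarrow>\<^sub>L 'a) \<Rightarrow> nat \<Rightarrow> ('a \<Rightarrow>\<^sub>L 'a)" where
  "sqrt_iter A 0 = 0"
| "sqrt_iter A (Suc n) = (1 / 2) *\<^sub>R (A + (sqrt_iter A n o\<^sub>L sqrt_iter A n))"

fun sqrt_iter_bound :: "nat \<Rightarrow> real" where
  "sqrt_iter_bound 0 = 0"
| "sqrt_iter_bound (Suc n) = (1 + (sqrt_iter_bound n)\<^sup>2) / 2"

lemma sqrt_iter_bound_range: "0 \<le> sqrt_iter_bound n" "sqrt_iter_bound n \<le> 1"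
proof (induction n)
  case (Suc n)
  {
    case 1 show ?case by simp
  next
    case 2 show ?case using Suc power_le_one[of "sqrt_iter_bound n" 2] by simp
  }
qed auto

lemma sqrt_iter_bound_mono: "sqrt_iter_bound n \<le> sqrt_iter_bound (Suc n)"
proof -
  have "0 \<le> (1 - sqrt_iter_bound n)\<^sup>2" by simp
  then show ?thesis by (simp add: power2_diff)
qed

text \<open>The increments decay too slowly for a geometric bound; they are summable because they
  telescope along a bounded increasing sequence.\<close>

lemma summable_sqrt_iter_bound: "summable (\<lambda>n. sqrt_iter_bound (Suc n) - sqrt_iter_bound n)"
proof -
  have "incseq sqrt_iter_bound"
    using sqrt_iter_bound_mono by (rule incseq_SucI)
  moreover have "\<forall>n. sqrt_iter_bound n \<le> 1"
    by (simp add: sqrt_iter_bound_range)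
  ultimately obtain l where "sqrt_iter_bound \<longlonglongrightarrow> l"
    using incseq_convergent by metis
  then show ?thesis
    by (rule sums_summable[OF telescope_sums])
qed

context
  fixes A :: "'a::real_normed_vector \<Rightarrow>\<^sub>L 'a"
begin

text \<open>The iterates are polynomials in \<open>A\<close>. Only linearity of \<open>f\<close> is
  assumed, because the lemma is applied to a square root not known to be bounded.\<close>

lemma sqrt_iter_commute:
  assumes "\<And>x. f (A x) = A (f x)" "linear f"
  shows "f (sqrt_iter A n x) = sqrt_iter A n (f x)"
proof (induction n arbitrary: x)
  case 0
  then show ?case by (simp add: linear_0[OF assms(2)])
next
  case (Suc n)
  then show ?case
    by (simp add: blinfun.add_left blinfun.scaleR_left linear_add[OF assms(2)]
        linear_scale[OF assms(2)] assms(1))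
qed

lemma sqrt_iter_commute_self: "sqrt_iter A n (sqrt_iter A m x) = sqrt_iter A m (sqrt_iter A n x)"
proof -
  have lin: "linear (blinfun_apply B)" for B :: "'a \<Rightarrow>\<^sub>L 'a"
    by (simp add: blinfun.bounded_linear_right bounded_linear.linear)
  have "sqrt_iter A n (A x) = A (sqrt_iter A n x)" for x
    by (rule sqrt_iter_commute[symmetric]) (auto simp: lin)
  then show ?thesis
    by (intro sqrt_iter_commute) (auto simp: lin)
qed

lemma norm_sqrt_iter:
  assumes "norm A \<le> 1"
  shows "norm (sqrt_iter A n) \<le> sqrt_iter_bound n"
proof (induction n)
  case (Suc n)
  have "norm (sqrt_iter A n o\<^sub>L sqrt_iter A n) \<le> norm (sqrt_iter A n) * norm (sqrt_iter A n)"
    by (rule norm_blinfun_compose)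
  also have "\<dots> \<le> sqrt_iter_bound n * sqrt_iter_bound n"
    using Suc by (intro mult_mono) (auto intro: sqrt_iter_bound_range)
  finally show ?case
    using assms norm_triangle_ineq[of A "sqrt_iter A n o\<^sub>L sqrt_iter A n"]
    by (simp add: power2_eq_square)
qed simp

text \<open>Commuting iterates allow the factorization of a difference of squares into sum times
  difference. The scalar iteration obeys the same recursion with equality, so the bound passes
  through the induction.\<close>

lemma norm_sqrt_iter_diff:
  assumes "norm A \<le> 1"
  shows "norm (sqrt_iter A (Suc n) - sqrt_iter A n) \<le> sqrt_iter_bound (Suc n) - sqrt_iter_bound n"
proof (induction n)
  case 0
  then show ?case using assms by (simp add: bounded_bilinear.zero_left[OF bounded_bilinear_blinfun_compose])
next
  case (Suc n)
  let ?X = "sqrt_iter A" and ?b = sqrt_iter_bound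
  have "?X (Suc (Suc n)) - ?X (Suc n) = (1 / 2) *\<^sub>R ((?X (Suc n) o\<^sub>L ?X (Suc n)) - (?X n o\<^sub>L ?X n))"
    by (subst (1 2) sqrt_iter.simps(2)) (simp add: algebra_simps del: sqrt_iter.simps)
  also have "(?X (Suc n) o\<^sub>L ?X (Suc n)) - (?X n o\<^sub>L ?X n)
      = (?X (Suc n) + ?X n) o\<^sub>L (?X (Suc n) - ?X n)"
    by (rule blinfun_eqI)
      (simp add: blinfun.bilinear_simps sqrt_iter_commute_self[of "Suc n" n] del: sqrt_iter.simps)
  also have "norm ((1 / 2) *\<^sub>R \<dots>) \<le> 1 / 2 * (norm (?X (Suc n) + ?X n) * norm (?X (Suc n) - ?X n))"
    by (simp add: norm_blinfun_compose del: sqrt_iter.simps)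
  also have "\<dots> \<le> 1 / 2 * ((?b (Suc n) + ?b n) * (?b (Suc n) - ?b n))"
    using norm_triangle_ineq[of "?X (Suc n)" "?X n"] norm_sqrt_iter[OF assms, of n]
      norm_sqrt_iter[OF assms, of "Suc n"] Suc sqrt_iter_bound_range
    by (intro mult_left_mono mult_mono) (auto simp del: sqrt_iter.simps sqrt_iter_bound.simps)
  also have "\<dots> = ?b (Suc (Suc n)) - ?b (Suc n)"
    by (subst (3 4) sqrt_iter_bound.simps(2))
      (simp add: field_simps power2_eq_square del: sqrt_iter_bound.simps)
  finally show ?case .
qed

end

lemma sqrt_iter_convergent:
  fixes A :: "'a::banach \<Rightarrow>\<^sub>L 'a"
  assumes "norm A \<le> 1"
  obtains X where "sqrt_iter A \<longlonglongrightarrow> X" "norm X \<le> 1" "X = (1 / 2) *\<^sub>R (A + (X o\<^sub>L X))"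
proof -
  have "summable (\<lambda>n. norm (sqrt_iter A (Suc n) - sqrt_iter A n))"
    using norm_sqrt_iter_diff[OF assms]
    by (intro summable_comparison_test'[OF summable_sqrt_iter_bound, of 0]) (simp del: sqrt_iter.simps)
  then have "summable (\<lambda>n. sqrt_iter A (Suc n) - sqrt_iter A n)"
    by (rule summable_norm_cancel)
  then obtain X where "(\<lambda>n. \<Sum>k<n. sqrt_iter A (Suc k) - sqrt_iter A k) \<longlonglongrightarrow> X"
    using summable_LIMSEQ by blast
  then have X: "sqrt_iter A \<longlonglongrightarrow> X"
    unfolding sum_lessThan_telescope by simp
  have "(\<lambda>n. (1 / 2) *\<^sub>R (A + (sqrt_iter A n o\<^sub>L sqrt_iter A n))) \<longlonglongrightarrow> (1 / 2) *\<^sub>R (A + (X o\<^sub>L X))"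
    using X by (intro tendsto_intros bounded_bilinear.tendsto[OF bounded_bilinear_blinfun_compose])
  moreover have "(\<lambda>n. sqrt_iter A (Suc n)) \<longlonglongrightarrow> X"
    using X by (rule LIMSEQ_Suc)
  ultimately have "X = (1 / 2) *\<^sub>R (A + (X o\<^sub>L X))"
    by (simp add: LIMSEQ_unique)
  moreover have "norm X \<le> 1"
    using norm_sqrt_iter[OF assms] sqrt_iter_bound_range(2)
    by (intro tendsto_upperbound[OF tendsto_norm[OF X]] always_eventually allI)
      (auto intro: order_trans)
  ultimately show ?thesis using that X by blast
qed

text \<open>The hypothesis on \<open>c\<close> makes \<open>A = 1 - B / c\<close> a contraction. The
  limit \<open>X\<close> of the iteration then satisfies \<open>(1 - X)\<^sup>2 = B / c\<close>, and
  \<open>norm X \<le> 1\<close> makes \<open>1 - X\<close> positive. Any other root commutes with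
  \<open>B\<close>, hence with \<open>X\<close> and \<open>R\<close>, which gives
  uniqueness.\<close>

lemma bounded_positive_sqrt:
  fixes B :: "'a::chilbert \<Rightarrow> 'a"
  assumes B: "bounded_linear B" "hsymmetric B"
    and c: "c > 0" "\<And>x. (norm (B x))\<^sup>2 \<le> c * Re (hinner x (B x))"
  obtains R where "bounded_linear R" "hsymmetric R" "hpositive R" "\<And>x. R (R x) = B x"
    "\<And>f. hsymmetric f \<Longrightarrow> hpositive f \<Longrightarrow> (\<And>x. f (f x) = B x) \<Longrightarrow> f = R"
proof -
  interpret B: bounded_linear B by fact
  have B_pos: "0 \<le> Re (hinner x (B x))" for x
    using c(2)[of x] c(1) by (smt (verit) zero_le_mult_iff zero_le_power2)
  define A where "A = Blinfun (\<lambda>x. x - (1 / c) *\<^sub>R B x)"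
  have A: "A x = x - (1 / c) *\<^sub>R B x" for x
    unfolding A_def
    by (subst bounded_linear_Blinfun_apply) (auto intro!: bounded_linear_intros B.bounded_linear)
  have "norm A \<le> 1"
  proof (rule norm_blinfun_bound)
    fix x
    have "(norm (A x))\<^sup>2 = (norm x)\<^sup>2 - 2 / c * Re (hinner x (B x)) + (norm (B x))\<^sup>2 / c\<^sup>2"
      by (simp add: A norm_diff_sq hinner_scaleR_right power_divide)
    also have "\<dots> \<le> (norm x)\<^sup>2 - 2 / c * Re (hinner x (B x)) + c * Re (hinner x (B x)) / c\<^sup>2"
      using c(2)[of x] by (simp add: divide_right_mono)
    also have "\<dots> = (norm x)\<^sup>2 - Re (hinner x (B x)) / c"
      using c(1) by (simp add: field_simps power2_eq_square)
    also have "\<dots> \<le> (norm x)\<^sup>2"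
      using c(1) B_pos by simp
    finally show "norm (A x) \<le> 1 * norm x"
      using power2_le_imp_le by fastforce
  qed simp
  then obtain X where X: "sqrt_iter A \<longlonglongrightarrow> X" "norm X \<le> 1" "X = (1 / 2) *\<^sub>R (A + (X o\<^sub>L X))"
    by (rule sqrt_iter_convergent)
  have lim: "(\<lambda>n. sqrt_iter A n x) \<longlonglongrightarrow> X x" for x
    using X(1) by (intro blinfun.tendsto tendsto_const)
  have "hinner (sqrt_iter A n x) y = hinner x (sqrt_iter A n y)" for n x y
  proof (induction n arbitrary: x y)
    case (Suc n)
    then show ?case
      by (simp add: blinfun.add_left blinfun.scaleR_left hinner_scaleR_left hinner_scaleR_right
          hinner_add_left hinner_add_right A hinner_diff_left hinner_diff_right hsymmetricD[OF B(2)])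
  qed simp
  then have X_sym: "hinner (X x) y = hinner x (X y)" for x y
    using tendsto_hinner[OF lim[of x] tendsto_const[of y]] tendsto_hinner[OF tendsto_const[of x] lim[of y]]
    by (simp add: LIMSEQ_unique)
  have X_sq: "X (X x) = 2 *\<^sub>R X x - A x" for x
  proof -
    have "X x = (1 / 2) *\<^sub>R (A x + X (X x))"
      by (subst X(3)) (simp add: blinfun.bilinear_simps)
    then have "2 *\<^sub>R X x = 2 *\<^sub>R ((1 / 2) *\<^sub>R (A x + X (X x)))"
      by (rule arg_cong)
    then show ?thesis
      by (simp add: algebra_simps)
  qed
  define R where "R x = sqrt c *\<^sub>R (x - X x)" for x
  have "bounded_linear R"
    unfolding R_def by (intro bounded_linear_intros blinfun.bounded_linear_right)
  then have R_lin: "linear R" by (rule bounded_linear.linear)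
  have R_sym: "hsymmetric R"
    by (simp add: hsymmetric_def R_def hinner_scaleR_left hinner_scaleR_right hinner_diff_left
        hinner_diff_right X_sym)
  have R_pos: "hpositive R"
    unfolding hpositive_def
  proof
    fix x
    have "Re (hinner x (X x)) \<le> norm x * norm (X x)"
      using complex_Re_le_cmod hinner_cauchy_schwarz order_trans by blast
    also have "\<dots> \<le> norm x * (1 * norm x)"
      using norm_blinfun[of X x] mult_right_mono[OF X(2), of "norm x"]
      by (intro mult_left_mono) auto
    finally show "0 \<le> Re (hinner x (R x))"
      using c(1) by (simp add: R_def hinner_scaleR_right hinner_diff_right hinner_self_norm power2_eq_square)
  qed
  have R_sq: "R (R x) = B x" for x
  proof -
    have "R (R x) = c *\<^sub>R (x - 2 *\<^sub>R X x + X (X x))"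
      using c(1) by (simp add: R_def blinfun.bilinear_simps algebra_simps scaleR_2)
    also have "\<dots> = B x"
      using c(1) by (simp add: X_sq A algebra_simps)
    finally show ?thesis .
  qed
  have "f = R" if f: "hsymmetric f" "hpositive f" "\<And>x. f (f x) = B x" for f
  proof
    fix x
    interpret f: linear f
      using f(1) hsymmetric_clinear clinear_imp_linear by blast
    have "f (A x) = A (f x)" for x
      by (simp add: A f.diff f.scale flip: f(3))
    then have comm: "f (sqrt_iter A n x) = sqrt_iter A n (f x)" for n x
      by (intro sqrt_iter_commute f.linear_axioms)
    have "f (X x) = X (f x)" for x
    proof (rule hinner_ext)
      fix z
      have "(\<lambda>n. hinner (f z) (sqrt_iter A n x)) \<longlonglongrightarrow> hinner (f z) (X x)"
        "(\<lambda>n. hinner z (sqrt_iter A n (f x))) \<longlonglongrightarrow> hinner z (X (f x))"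
        by (intro tendsto_hinner tendsto_const lim)+
      then show "hinner z (f (X x)) = hinner z (X (f x))"
        by (simp add: hsymmetricD[OF f(1)] comm LIMSEQ_unique)
    qed
    then have R_comm: "f (R x) = R (f x)" for x
      by (simp add: R_def f.scale f.diff)
    \<comment> \<open>Equal squares and commutation give \<open>f y + R y = 0\<close>. Both forms
      are nonnegative, so each vanishes at \<open>y\<close>, whence \<open>f y = R y = 0\<close>;
      symmetry then makes \<open>y\<close> orthogonal to \<open>f x - R x\<close>, which is
      \<open>y\<close> itself.\<close>
    define y where "y = f x - R x"
    have "f y + R y = 0"
      by (simp add: y_def f.diff linear_diff[OF R_lin] f(3) R_sq R_comm)
    then have "Re (hinner y (f y)) + Re (hinner y (R y)) = 0"
      by (metis hinner_add_right hinner_zero_right plus_complex.sel(1) zero_complex.sel(1))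
    then have "Re (hinner y (f y)) = 0" "Re (hinner y (R y)) = 0"
      using hpositiveD[OF f(2), of y] hpositiveD[OF R_pos, of y] by linarith+
    then have "f y = 0" "R y = 0"
      using hpositive_eq_0 f R_sym R_pos by blast+
    then have "hinner y y = 0"
      by (subst (1) y_def) (simp add: hinner_diff_left hsymmetricD[OF f(1)] hsymmetricD[OF R_sym])
    then show "f x = R x" by (simp add: y_def)
  qed
  then show ?thesis
    using that \<open>bounded_linear R\<close> R_sym R_pos R_sq by blast
qed

section \<open>Unbounded operators\<close>

lemma lin_op_add:
  assumes "lin_op A" "A x = Some u" "A y = Some v"
  shows "A (x + y) = Some (u + v)"
proof -
  have "x \<in> dom A" "y \<in> dom A" using assms by auto
  then have "x + y \<in> dom A" "the (A (x + y)) = the (A x) + the (A y)"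
    using assms(1) by (auto simp: lin_op_def csubspace_add)
  then show ?thesis using assms by auto
qed

lemma lin_op_hscale:
  assumes "lin_op A" "A x = Some u"
  shows "A (hscale c x) = Some (hscale c u)"
proof -
  have "x \<in> dom A" using assms by auto
  then have "hscale c x \<in> dom A" "the (A (hscale c x)) = hscale c (the (A x))"
    using assms(1) by (auto simp: lin_op_def csubspace_hscale)
  then show ?thesis using assms by auto
qed

lemma lin_op_diff:
  assumes "lin_op A" "A x = Some u" "A y = Some v"
  shows "A (x - y) = Some (u - v)"
  using lin_op_add[OF assms(1,2) lin_op_hscale[OF assms(1,3), of "- 1"]]
  by (simp add: hscale_minus_one)

lemma lin_op_zero:
  assumes "lin_op A"
  shows "A 0 = Some 0"
proof -
  have "0 \<in> dom A" using assms by (simp add: lin_op_def csubspace_zero)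
  then obtain u where "A 0 = Some u" by auto
  then show ?thesis using lin_op_diff[OF assms, of 0 u 0 u] by simp
qed

lemma lin_opI:
  assumes "A 0 = Some 0"
    and "\<And>x u y v. A x = Some u \<Longrightarrow> A y = Some v \<Longrightarrow> A (x + y) = Some (u + v)"
    and "\<And>c x u. A x = Some u \<Longrightarrow> A (hscale c x) = Some (hscale c u)"
  shows "lin_op A"
  unfolding lin_op_def csubspace_def
proof (intro conjI ballI allI)
  show "0 \<in> dom A" using assms(1) by auto
next
  fix x y assume "x \<in> dom A" "y \<in> dom A"
  then obtain u v where "A x = Some u" "A y = Some v" by auto
  then show "x + y \<in> dom A" "the (A (x + y)) = the (A x) + the (A y)"
    using assms(2) by auto
next
  fix c x assume "x \<in> dom A"
  then obtain u where "A x = Some u" by auto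
  then show "hscale c x \<in> dom A" "the (A (hscale c x)) = hscale c (the (A x))"
    using assms(3) by auto
qed

lemma csubspace_ran:
  assumes "lin_op A"
  shows "csubspace (ran A)"
  unfolding csubspace_def ran_def
  using lin_op_zero[OF assms] lin_op_add[OF assms] lin_op_hscale[OF assms] by blast

lemma csubspace_kernel_op:
  assumes "lin_op A"
  shows "csubspace (kernel_op A)"
  unfolding csubspace_def kernel_op_def
  using lin_op_zero[OF assms] lin_op_add[OF assms, of _ 0 _ 0] lin_op_hscale[OF assms, of _ 0] by simp

lemma closed_op_tendsto:
  assumes "closed_op A" "\<And>n. A (u n) = Some (v n)" "u \<longlonglongrightarrow> x" "v \<longlonglongrightarrow> y"
  shows "A x = Some y"
proof -
  have "closed (op_graph A)" using assms(1) by (simp add: closed_op_def)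
  moreover have "(u n, v n) \<in> op_graph A" for n using assms(2) by (simp add: op_graph_def)
  ultimately have "(x, y) \<in> op_graph A"
    by (rule closed_sequentially[OF _ _ tendsto_Pair[OF assms(3,4)]])
  then show ?thesis by (simp add: op_graph_def)
qed

lemma closed_kernel_op:
  assumes "closed_op A"
  shows "closed (kernel_op A)"
  unfolding closed_sequential_limits
proof (intro allI impI)
  fix u x assume "(\<forall>n. u n \<in> kernel_op A) \<and> u \<longlonglongrightarrow> x"
  then show "x \<in> kernel_op A"
    using closed_op_tendsto[OF assms, of u "\<lambda>_. 0" x 0] by (simp add: kernel_op_def)
qed

text \<open>Density leaves at most one candidate for the description in \<open>op_adj\<close>, so
  the adjoint can be handled through its graph.\<close>

lemma op_adj_iff:
  assumes "densely_defined A"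
  shows "op_adj A y = Some v \<longleftrightarrow> (\<forall>x u. A x = Some u \<longrightarrow> hinner u y = hinner x v)"
proof -
  let ?P = "\<lambda>z. \<forall>x\<in>dom A. hinner (the (A x)) y = hinner x z"
  have uniq: "z = z'" if "?P z" "?P z'" for z z'
  proof -
    have "z - z' \<in> orth (dom A)"
      using that by (auto simp: orth_def hinner_diff_right)
    then show ?thesis
      using assms orth_dense[of "dom A"] by (auto simp: densely_defined_def)
  qed
  have eq: "?P v \<longleftrightarrow> (\<forall>x u. A x = Some u \<longrightarrow> hinner u y = hinner x v)" for v
    by (auto simp: dom_def)
  have "op_adj A y = Some v \<longleftrightarrow> ?P v"
  proof
    assume "op_adj A y = Some v"
    then have ex: "\<exists>z. ?P z" and v: "v = (THE z. ?P z)"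
      by (auto simp: op_adj_def split: if_splits)
    from ex obtain z where z: "?P z" by blast
    have "(THE z. ?P z) = z"
      by (rule the_equality[of ?P]) (use z uniq in blast)+
    then show "?P v" using v z by simp
  next
    assume v: "?P v"
    have "(THE z. ?P z) = v"
      by (rule the_equality[of ?P]) (use v uniq in blast)+
    then show "op_adj A y = Some v"
      using v by (auto simp: op_adj_def)
  qed
  then show ?thesis using eq by simp
qed

lemma selfadjoint_symmetric:
  assumes "selfadjoint S" "S x = Some u" "S y = Some v"
  shows "hinner u y = hinner x v"
  using assms op_adj_iff[of S y v] by (auto simp: selfadjoint_def)

section \<open>Everywhere defined operators as partial maps\<close>

lemma bounded_op_lin: "clinear f \<Longrightarrow> lin_op (\<lambda>x. Some (f x))"
  by (rule lin_opI) (auto simp: clinear_add clinear_hscale linear_0[OF clinear_imp_linear])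

lemma bounded_op_ran: "ran (\<lambda>x. Some (f x)) = range f"
  by (auto simp: ran_def)

lemma bounded_op_dense: "densely_defined (\<lambda>x. Some (f x))"
  by (simp add: densely_defined_def dom_def)

lemma bounded_op_closed:
  assumes "clinear f" "bounded_linear f"
  shows "closed_op (\<lambda>x. Some (f x))"
proof -
  have "op_graph (\<lambda>x. Some (f x)) = {p. snd p = f (fst p)}"
    by (auto simp: op_graph_def)
  moreover have "closed {p. snd p = f (fst p)}"
    by (intro closed_Collect_eq continuous_intros bounded_linear.continuous_on[OF assms(2)])
  ultimately show ?thesis
    using bounded_op_lin[OF assms(1)] by (simp add: closed_op_def)
qed

lemma bounded_op_adj:
  assumes "\<And>x y. hinner (f x) y = hinner x (g y)"
  shows "op_adj (\<lambda>x. Some (f x)) = (\<lambda>y. Some (g y))"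
  by (rule ext) (simp add: op_adj_iff[OF bounded_op_dense] assms)

text \<open>The description in \<open>op_abs\<close> ranges over partial maps, but a competitor with
  everywhere defined square is itself everywhere defined; uniqueness among functions then
  suffices.\<close>

lemma op_abs_bounded:
  assumes adj: "\<And>x y. hinner (g y) x = hinner y (f x)"
    and R: "hsymmetric R" "hpositive R" "\<And>x. R (R x) = g (f x)"
    and uniq: "\<And>h. hsymmetric h \<Longrightarrow> hpositive h \<Longrightarrow> (\<And>x. h (h x) = g (f x)) \<Longrightarrow> h = R"
  shows "op_abs (\<lambda>x. Some (f x)) = (\<lambda>x. Some (R x))"
proof -
  have adj': "hinner (f x) y = hinner x (g y)" for x y
    by (metis adj hinner_commute)
  have comp: "op_adj (\<lambda>x. Some (f x)) \<circ>\<^sub>m (\<lambda>x. Some (f x)) = (\<lambda>x. Some (g (f x)))"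
    by (simp add: bounded_op_adj[OF adj'] map_comp_def)
  show ?thesis
    unfolding op_abs_def comp
  proof (rule the_equality)
    have "selfadjoint (\<lambda>x. Some (R x))"
      using bounded_op_lin[OF hsymmetric_clinear[OF R(1)]] bounded_op_adj[of R R] R(1)
      by (simp add: selfadjoint_def bounded_op_dense hsymmetricD)
    moreover have "positive_op (\<lambda>x. Some (R x))"
      using R by (simp add: positive_op_def hsymmetric_Im hpositiveD)
    ultimately show "selfadjoint (\<lambda>x. Some (R x)) \<and> positive_op (\<lambda>x. Some (R x)) \<and>
        (\<lambda>x. Some (R x)) \<circ>\<^sub>m (\<lambda>x. Some (R x)) = (\<lambda>x. Some (g (f x)))"
      by (simp add: map_comp_def R(3))
  next
    fix S assume S: "selfadjoint S \<and> positive_op S \<and> S \<circ>\<^sub>m S = (\<lambda>x. Some (g (f x)))"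
    define h where "h x = the (S x)" for x
    have SS: "(S \<circ>\<^sub>m S) x = Some (g (f x))" for x
      using S by simp
    have h: "S x = Some (h x)" for x
      using SS[of x] by (auto simp: h_def map_comp_def split: option.splits)
    have "hsymmetric h"
      using S selfadjoint_symmetric h by (fastforce simp: hsymmetric_def)
    moreover have "hpositive h"
      using S h by (auto simp: hpositive_def positive_op_def dom_def)
    moreover have "h (h x) = g (f x)" for x
      using SS[of x] by (simp add: map_comp_def h)
    ultimately have "h = R" by (rule uniq)
    then show "S = (\<lambda>x. Some (R x))" using h by auto
  qed
qed

section \<open>Closed operators with closed range\<close>

locale closed_range_op =
  fixes T :: "('a::chilbert, 'b::chilbert) op"
  assumes closed: "closed_op T" and dense: "densely_defined T" and closed_ran: "closed (ran T)"
begin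

abbreviation N :: "'a set" where "N \<equiv> kernel_op T"
abbreviation C :: "'a set" where "C \<equiv> orth N"
abbreviation P :: "'b \<Rightarrow> 'b" where "P \<equiv> oproj (ran T)"
abbreviation Q :: "'a \<Rightarrow> 'a" where "Q \<equiv> oproj C"

lemma lin: "lin_op T"
  using closed by (simp add: closed_op_def)

lemmas T_add = lin_op_add[OF lin]
  and T_diff = lin_op_diff[OF lin]
  and T_hscale = lin_op_hscale[OF lin]
  and T_zero = lin_op_zero[OF lin]

lemmas ran_T = csubspace_ran[OF lin] closed_ran
  and C = csubspace_orth[of N] closed_orth[of N]

lemma orth_C: "orth C = N"
  using orth_orth_eq_closure[OF csubspace_kernel_op[OF lin]] closed_kernel_op[OF closed]
  by simp

lemma N_iff: "x \<in> N \<longleftrightarrow> T x = Some 0"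
  by (simp add: kernel_op_def)

lemma T_diff_Q: "T (x - Q x) = Some 0"
  using oproj_diff[OF C, of x] by (simp add: orth_C N_iff)

lemma T_Q: "T x = Some u \<Longrightarrow> T (Q x) = Some u"
  using T_diff[OF _ T_diff_Q[of x], of x u] by simp

lemma Q_N: "x \<in> N \<Longrightarrow> Q x = 0"
  by (rule oproj_orth[OF C]) (simp add: orth_C)

lemma Q_eq_0: "Q x = 0 \<longleftrightarrow> x \<in> N"
  using T_diff_Q[of x] Q_N[of x] by (auto simp: N_iff)

lemma T_inj_on_C:
  assumes "x \<in> C" "y \<in> C" "T x = Some u" "T y = Some u"
  shows "x = y"
proof -
  have "x - y \<in> N" using T_diff[OF assms(3,4)] by (simp add: N_iff)
  moreover have "x - y \<in> C" using assms by (simp add: csubspace_diff C)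
  ultimately show ?thesis using orth_Int_self by fastforce
qed

text \<open>\<open>T\<close> is injective on \<open>C\<close> and attains its whole range there.
  Inserting \<open>P\<close> makes \<open>L\<close> total, as the closed graph theorem requires; the
  graph is closed because \<open>T\<close> and \<open>C\<close> are closed and \<open>P\<close> is
  continuous.\<close>

lemma bounded_mp_inverse:
  obtains L where "clinear L" "bounded_linear L" "\<And>y. L y \<in> C" "\<And>y. T (L y) = Some (P y)"
proof -
  have "\<exists>x. x \<in> C \<and> T x = Some (P y)" for y
  proof -
    have "P y \<in> ran T" by (rule oproj_in[OF ran_T])
    then obtain x where "T x = Some (P y)" by (auto simp: ran_def)
    then show ?thesis using T_Q oproj_in[OF C] by blast
  qed
  then obtain L where L: "\<And>y. L y \<in> C" "\<And>y. T (L y) = Some (P y)"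
    by metis
  have lin: "clinear L"
    unfolding clinear_def
  proof (intro conjI allI)
    fix x y
    show "L (x + y) = L x + L y"
      by (rule T_inj_on_C[OF L(1) _ L(2)])
        (simp_all add: csubspace_add C L T_add oproj_add[OF ran_T])
  next
    fix c x
    show "L (hscale c x) = hscale c (L x)"
      by (rule T_inj_on_C[OF L(1) _ L(2)])
        (simp_all add: csubspace_hscale C L T_hscale oproj_hscale[OF ran_T])
  qed
  have "bounded_linear L"
  proof (rule closed_graph_bounded_linear)
    show "linear L" using lin by (rule clinear_imp_linear)
    fix u x y assume u: "u \<longlonglongrightarrow> x" "(\<lambda>n. L (u n)) \<longlonglongrightarrow> y"
    have "(\<lambda>n. P (u n)) \<longlonglongrightarrow> P x"
      using u(1) by (rule bounded_linear.tendsto[OF bounded_linear_oproj[OF ran_T]])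
    then have "T y = Some (P x)"
      using closed_op_tendsto[OF closed L(2) u(2)] by blast
    moreover have "y \<in> C"
      using closed_sequentially[OF C(2) _ u(2)] L(1) by blast
    ultimately show "L x = y"
      using T_inj_on_C L by blast
  qed
  then show ?thesis using that lin L by blast
qed

end

text \<open>Here \<open>L\<close> is the Moore--Penrose inverse of \<open>T\<close>, \<open>W\<close> its adjoint, which turns out to be the
  generalized Cauchy dual of \<open>T\<close>, and \<open>R\<close> the positive square root of \<open>L W = (T\<^sup>* T)\<^sup>\<dagger>\<close>.\<close>

locale closed_range_sqrt = closed_range_op T
  for T :: "('a::chilbert, 'b::chilbert) op" +
  fixes L :: "'b \<Rightarrow> 'a" and W :: "'a \<Rightarrow> 'b" and R :: "'a \<Rightarrow> 'a"
  assumes L_in_C: "L y \<in> C" and T_L: "T (L y) = Some (P y)"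
    and L_clinear: "clinear L"
    and W_clinear: "clinear W" and W_bounded: "bounded_linear W"
    and L_W_adj: "hinner (L y) x = hinner y (W x)"
    and R_sym: "hsymmetric R" and R_pos: "hpositive R"
    and R_R: "R (R x) = L (W x)"
    and R_unique: "hsymmetric f \<Longrightarrow> hpositive f \<Longrightarrow> (\<And>x. f (f x) = L (W x)) \<Longrightarrow> f = R"
begin

interpretation L: linear L using L_clinear by (rule clinear_imp_linear)
interpretation W: linear W using W_clinear by (rule clinear_imp_linear)
interpretation R: linear R using hsymmetric_clinear[OF R_sym] by (rule clinear_imp_linear)

lemma L_T: "T x = Some u \<Longrightarrow> L u = Q x"
proof (rule T_inj_on_C[OF L_in_C oproj_in[OF C] T_L])
  assume u: "T x = Some u"
  then have "u \<in> ran T" by (auto simp: ran_def)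
  then show "T (Q x) = Some (P u)" using T_Q[OF u] by (simp add: oproj_ident[OF ran_T])
qed

lemma L_eq_0: "y \<in> orth (ran T) \<Longrightarrow> L y = 0"
  by (rule T_inj_on_C[OF L_in_C csubspace_zero[OF C(1)] T_L])
    (simp add: T_zero oproj_orth[OF ran_T])

text \<open>\<open>L\<close> kills the complement of \<open>ran T\<close>, so its adjoint maps into
  the double complement, which is \<open>ran T\<close> again by closedness.\<close>

lemma W_in_ran: "W z \<in> ran T"
proof -
  have "W z \<in> orth (orth (ran T))"
    by (auto simp: orth_def[of "orth (ran T)"] L_eq_0 simp flip: L_W_adj)
  then show ?thesis
    using orth_orth_eq_closure[OF ran_T(1)] ran_T(2) by simp
qed

lemma T_L_W: "T (L (W z)) = Some (W z)"
  by (simp add: T_L oproj_ident[OF ran_T W_in_ran])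

lemma W_N: "z \<in> N \<Longrightarrow> W z = 0"
proof (rule hinner_ext)
  fix y assume "z \<in> N"
  then have "hinner z (L y) = 0" using L_in_C[of y] by (simp add: orth_def)
  then show "hinner y (W z) = hinner y 0"
    using hinner_eq_0_commute by (simp flip: L_W_adj) blast
qed

lemma W_Q: "W (Q z) = W z"
  using W_N[of "z - Q z"] oproj_diff[OF C, of z] by (simp add: orth_C W.diff)

lemmas adj_T_iff = op_adj_iff[OF dense]

lemma adj_T_W: "z \<in> C \<Longrightarrow> op_adj T (W z) = Some z"
  by (auto simp: adj_T_iff L_T hinner_oproj_left[OF C] simp flip: L_W_adj)

lemma adj_T_in_C: "op_adj T y = Some v \<Longrightarrow> v \<in> C"
  unfolding adj_T_iff orth_def by (auto simp: N_iff) (metis hinner_zero_left)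

abbreviation TT :: "('a, 'a) op" where "TT \<equiv> op_adj T \<circ>\<^sub>m T"

text \<open>This trades the composition of two unbounded operators for an equation between bounded
  ones; all later facts about \<open>TT\<close> pass through it.\<close>

lemma TT_iff: "TT x = Some u \<longleftrightarrow> u \<in> C \<and> L (W u) = Q x"
proof
  assume "TT x = Some u"
  then obtain w where w: "T x = Some w" "op_adj T w = Some u"
    by (auto simp: map_comp_Some_iff)
  then have uC: "u \<in> C" using adj_T_in_C by blast
  have d: "T (x - L (W u)) = Some (w - W u)"
    using T_diff[OF w(1) T_L_W] .
  \<comment> \<open>The adjoint takes the value \<open>u\<close> at both \<open>w\<close> and
    \<open>W u\<close>, so their difference is orthogonal to the range of \<open>T\<close>, to which
    it belongs.\<close>
  have "hinner (w - W u) (w - W u) = 0"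
    using w(2) adj_T_W[OF uC] d unfolding adj_T_iff by (simp add: hinner_diff_right)
  then have "x - L (W u) \<in> N" using d by (simp add: N_iff)
  then have "Q (x - L (W u)) = 0" by (rule Q_N)
  then have "Q x = Q (L (W u))"
    using oproj_add[OF C, of "x - L (W u)" "L (W u)"] by simp
  then show "u \<in> C \<and> L (W u) = Q x"
    using uC by (simp add: oproj_ident[OF C L_in_C])
next
  assume u: "u \<in> C \<and> L (W u) = Q x"
  have "T x = Some (W u)"
    using T_add[OF T_L_W[of u] T_diff_Q[of x]] u by simp
  then show "TT x = Some u"
    using adj_T_W u by (auto simp: map_comp_Some_iff)
qed

text \<open>By \<open>TT_iff\<close> both \<open>z\<close> and 0 are the value of \<open>TT\<close>
  at 0.\<close>

lemma L_W_inj: "z \<in> C \<Longrightarrow> L (W z) = 0 \<Longrightarrow> z = 0"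
  using TT_iff[of 0 z] TT_iff[of 0 0]
  by (simp add: Q_N csubspace_zero[OF C(1)] csubspace_zero[OF csubspace_kernel_op[OF lin]] L.zero W.zero)

lemma R_N: "n \<in> N \<Longrightarrow> R n = 0"
proof -
  assume n: "n \<in> N"
  have "hinner (R n) (R n) = hinner n (R (R n))" by (rule hsymmetricD[OF R_sym])
  also have "\<dots> = 0" by (simp add: R_R W_N[OF n] L.zero)
  finally show ?thesis by simp
qed

lemma R_in_C: "R z \<in> C"
  by (auto simp: orth_def R_N simp flip: hsymmetricD[OF R_sym])

lemma R_inj: "z \<in> C \<Longrightarrow> R z = 0 \<Longrightarrow> z = 0"
  using L_W_inj[of z] by (simp flip: R_R add: R.zero)

lemma R_Q: "R (Q z) = R z"
  using R_N[of "z - Q z"] oproj_diff[OF C, of z] by (simp add: orth_C R.diff)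

lemma kernel_R: "R z = 0 \<Longrightarrow> z \<in> N"
  using R_inj[OF oproj_in[OF C], of z] by (simp add: R_Q Q_eq_0)

text \<open>The modulus of \<open>T\<close> is the Moore--Penrose inverse of \<open>R\<close>.\<close>

definition S :: "('a, 'a) op" where
  "S x = (if \<exists>z\<in>C. R z = Q x then Some (THE z. z \<in> C \<and> R z = Q x) else None)"

lemma S_iff: "S x = Some z \<longleftrightarrow> z \<in> C \<and> R z = Q x"
proof -
  have uniq: "z = z'" if "z \<in> C \<and> R z = Q x" "z' \<in> C \<and> R z' = Q x" for z z'
    using that R_inj[of "z - z'"] by (simp add: csubspace_diff[OF C(1)] R.diff)
  have the: "(THE z. z \<in> C \<and> R z = Q x) = z" if "z \<in> C \<and> R z = Q x" for z
    using that uniq by blast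
  show ?thesis
    unfolding S_def using the by auto
qed

lemma S_R: "z \<in> C \<Longrightarrow> S (R z) = Some z"
  by (simp add: S_iff oproj_ident[OF C R_in_C])

lemma S_N: "x \<in> N \<Longrightarrow> S x = Some 0"
  by (simp add: S_iff Q_N csubspace_zero[OF C(1)] R.zero)

lemma ran_S: "ran S = C"
  using S_iff S_R by (auto simp: ran_def)

lemma lin_S: "lin_op S"
proof (rule lin_opI)
  show "S 0 = Some 0"
    by (simp add: S_N csubspace_zero[OF csubspace_kernel_op[OF lin]])
qed (auto simp: S_iff csubspace_add[OF C(1)] csubspace_hscale[OF C(1)] oproj_add[OF C]
    oproj_hscale[OF C] R.add clinear_hscale[OF hsymmetric_clinear[OF R_sym]])

text \<open>A vector \<open>w\<close> orthogonal to the domain lies in \<open>C\<close>, because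
  \<open>N\<close> is part of the domain; orthogonality to \<open>R (R w)\<close> then forces
  \<open>R w = 0\<close>.\<close>

lemma dense_S: "densely_defined S"
  unfolding densely_defined_def
proof (rule dense_if_orth_trivial)
  show "csubspace (dom S)" using lin_S by (simp add: lin_op_def)
  show "orth (dom S) \<subseteq> {0}"
  proof
    fix w assume w: "w \<in> orth (dom S)"
    have "N \<subseteq> dom S" using S_N by blast
    then have wC: "w \<in> C" using w orth_antimono by blast
    have "R (R w) \<in> dom S" using S_R[OF R_in_C] by blast
    then have "hinner (R w) (R w) = 0"
      using w by (simp add: orth_def flip: hsymmetricD[OF R_sym])
    then show "w \<in> {0}" using R_inj[OF wC] by simp
  qed
qed

lemma S_symmetric:
  assumes "S x = Some z" "S y = Some u"
  shows "hinner z y = hinner x u"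
proof -
  have z: "z \<in> C" "R z = Q x" and u: "u \<in> C" "R u = Q y"
    using assms by (auto simp: S_iff)
  have "hinner z y = hinner z (R u)" using z u by (simp add: hinner_oproj_right[OF C])
  also have "\<dots> = hinner (R z) u" by (simp add: hsymmetricD[OF R_sym])
  also have "\<dots> = hinner x u" using z u by (simp add: hinner_oproj_left[OF C])
  finally show ?thesis .
qed

text \<open>Testing the adjoint relation on \<open>N\<close> puts \<open>v\<close> into
  \<open>C\<close>; testing it on the vectors \<open>R z\<close> with \<open>z\<close> in
  \<open>C\<close> gives \<open>Q y = R v\<close>. Together these say
  \<open>S y = Some v\<close>.\<close>

lemma selfadjoint_S: "selfadjoint S"
proof -
  have "op_adj S y = Some v \<longleftrightarrow> S y = Some v" for y v
  proof
    assume "op_adj S y = Some v"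
    then have adj: "S x = Some u \<Longrightarrow> hinner u y = hinner x v" for x u
      by (simp add: op_adj_iff[OF dense_S])
    have vC: "v \<in> C"
      unfolding orth_def using adj[OF S_N] by simp
    have "y - R v \<in> orth C"
      unfolding orth_def[of C] using adj[OF S_R] by (simp add: hinner_diff_right hsymmetricD[OF R_sym])
    then have "Q y = R v"
      by (intro oproj_unique[OF C]) (rule R_in_C)
    then show "S y = Some v" using vC by (simp add: S_iff)
  next
    assume "S y = Some v"
    then show "op_adj S y = Some v"
      using S_symmetric by (auto simp: op_adj_iff[OF dense_S])
  qed
  then have "op_adj S y = S y" for y
    by (metis option.exhaust)
  then have "op_adj S = S" ..
  then show ?thesis using lin_S dense_S by (simp add: selfadjoint_def)
qed

lemma positive_S: "positive_op S"
  unfolding positive_op_def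
proof
  fix x assume "x \<in> dom S"
  then obtain z where z: "S x = Some z" by auto
  then have "hinner x z = hinner (R z) z"
    by (auto simp: S_iff hinner_oproj_left[OF C])
  then have "hinner x z = hinner z (R z)"
    by (simp add: hsymmetricD[OF R_sym])
  then show "Im (hinner x (the (S x))) = 0 \<and> 0 \<le> Re (hinner x (the (S x)))"
    using z by (simp add: hsymmetric_Im[OF R_sym] hpositiveD[OF R_pos])
qed

lemma S_S: "S \<circ>\<^sub>m S = TT"
proof
  fix x
  have "(S \<circ>\<^sub>m S) x = Some u \<longleftrightarrow> TT x = Some u" for u
  proof -
    have "(S \<circ>\<^sub>m S) x = Some u \<longleftrightarrow> (\<exists>z. z \<in> C \<and> R z = Q x \<and> u \<in> C \<and> R u = z)"
      by (auto simp: map_comp_Some_iff S_iff oproj_ident[OF C])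
    also have "\<dots> \<longleftrightarrow> u \<in> C \<and> L (W u) = Q x"
      using R_in_C by (auto simp flip: R_R)
    finally show ?thesis by (simp only: TT_iff)
  qed
  then show "(S \<circ>\<^sub>m S) x = TT x" by (metis option.exhaust)
qed

text \<open>For any other square root \<open>S'\<close>, the operator \<open>S' L W\<close> is a positive square root of \<open>L W\<close>,
  so uniqueness reduces to the bounded case.\<close>

lemma sqrt_TT_unique:
  assumes S': "selfadjoint S'" "positive_op S'" "S' \<circ>\<^sub>m S' = TT"
  shows "S' = S"
proof -
  have lin': "lin_op S'" using S' by (simp add: selfadjoint_def)
  note sym = selfadjoint_symmetric[OF S'(1)]
  have root: "(\<exists>w. S' x = Some w \<and> S' w = Some u) \<longleftrightarrow> u \<in> C \<and> L (W u) = Q x" for x u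
    using TT_iff[of x u] unfolding S'(3)[symmetric] map_comp_Some_iff .
  have ker: "S' x = Some 0 \<longleftrightarrow> x \<in> N" for x
  proof
    assume "S' x = Some 0"
    then have "L (W 0) = Q x" using root[of x 0] lin_op_zero[OF lin'] by blast
    then show "x \<in> N" by (simp add: W.zero L.zero flip: Q_eq_0)
  next
    assume "x \<in> N"
    then have "\<exists>w. S' x = Some w \<and> S' w = Some 0"
      using root[of x 0] by (simp add: Q_N W.zero L.zero csubspace_zero[OF C(1)])
    then obtain w where w: "S' x = Some w" "S' w = Some 0" by blast
    then have "hinner w w = 0" using sym[OF w(1,2)] by simp
    then show "S' x = Some 0" using w by simp
  qed
  have ran': "u \<in> C" if "S' x = Some u" for x u
    unfolding orth_def using that sym[OF _ that, of _ 0] by (auto simp flip: ker)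
  \<comment> \<open>The intermediate vector, called \<open>f z\<close> below, is the value of
    \<open>S'\<close> at \<open>L (W z)\<close>; the second equation makes \<open>S'\<close> invert
    \<open>f\<close> on \<open>C\<close>.\<close>
  have "\<exists>w. S' (L (W z)) = Some w \<and> S' w = Some (Q z)" for z
    using root[of "L (W z)" "Q z"] by (simp add: oproj_in[OF C] W_Q oproj_ident[OF C L_in_C])
  then obtain f where f: "\<And>z. S' (L (W z)) = Some (f z)" "\<And>z. S' (f z) = Some (Q z)"
    by metis
  have fC: "f z \<in> C" for z using ran' f(1) by blast
  have inj': "x = y" if "x \<in> C" "y \<in> C" "S' x = Some u" "S' y = Some u" for x y u
  proof -
    have "x - y \<in> N" using lin_op_diff[OF lin' that(3,4)] by (simp flip: ker)
    then show ?thesis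
      using orth_Int_self[of "x - y" N] that csubspace_diff[OF C(1)] by simp
  qed
  have "f = R"
  proof (rule R_unique)
    show "hsymmetric f"
      unfolding hsymmetric_def
    proof (intro allI)
      fix x y
      have "hinner (f x) y = hinner (f x) (Q y)" by (simp add: hinner_oproj_right[OF C fC])
      also have "\<dots> = hinner (Q x) (f y)" using sym[OF f(2) f(2)] by simp
      also have "\<dots> = hinner x (f y)" by (simp add: hinner_oproj_left[OF C fC])
      finally show "hinner (f x) y = hinner x (f y)" .
    qed
    show "hpositive f"
      unfolding hpositive_def
    proof
      fix x
      have "hinner x (f x) = hinner (Q x) (f x)" by (simp add: hinner_oproj_left[OF C fC])
      also have "\<dots> = hinner (f x) (Q x)" using sym[OF f(2) f(2)] by simp
      finally have eq: "hinner x (f x) = hinner (f x) (Q x)" .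
      have "f x \<in> dom S'" using f(2)[of x] by blast
      then show "0 \<le> Re (hinner x (f x))"
        using S'(2) f(2)[of x] unfolding positive_op_def eq by (metis option.sel)
    qed
    fix x
    have "S' (f (f x)) = Some (f x)" using f(2)[of "f x"] by (simp add: oproj_ident[OF C fC])
    then show "f (f x) = L (W x)"
      using inj'[OF fC L_in_C _ f(1)] by blast
  qed
  \<comment> \<open>Up to a vector of \<open>N\<close>, which \<open>S'\<close> kills, the only
    preimage of \<open>z\<close> under \<open>S'\<close> is \<open>f z = R z\<close>; this is the
    equation defining \<open>S\<close>.\<close>
  have "S' x = Some z \<longleftrightarrow> S x = Some z" for x z
  proof
    assume z: "S' x = Some z"
    then have zC: "z \<in> C" by (rule ran')
    then have "S' (f z) = Some z" using f(2)[of z] by (simp add: oproj_ident[OF C])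
    then have "x - f z \<in> N" using lin_op_diff[OF lin' z] by (simp flip: ker)
    then have "Q x = f z" by (intro oproj_unique[OF C]) (simp_all add: orth_C fC)
    then show "S x = Some z" using zC \<open>f = R\<close> by (simp add: S_iff)
  next
    assume "S x = Some z"
    then have z: "z \<in> C" "f z = Q x" using \<open>f = R\<close> by (auto simp: S_iff)
    then have "S' (Q x) = Some z" using f(2)[of z] by (simp add: oproj_ident[OF C])
    moreover have "S' (x - Q x) = Some 0"
      using oproj_diff[OF C, of x] by (simp add: ker orth_C)
    ultimately show "S' x = Some z"
      using lin_op_add[OF lin'] by fastforce
  qed
  then show ?thesis by (metis ext option.exhaust)
qed

section \<open>Moduli, the generalized Cauchy dual and closures of ranges\<close>

lemma op_abs_T: "op_abs T = S"
  unfolding op_abs_def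
  using selfadjoint_S positive_S S_S sqrt_TT_unique by (intro the_equality) blast+

lemma op_abs_W: "op_abs (\<lambda>x. Some (W x)) = (\<lambda>x. Some (R x))"
  by (rule op_abs_bounded[OF L_W_adj R_sym R_pos R_R R_unique])

text \<open>\<open>TT\<close> has the closed range \<open>C\<close>, so every \<open>y\<close>
  splits and the inverse is total. \<open>TT\<close> sends \<open>L (W y)\<close> to
  \<open>Q y\<close>, the component of \<open>y\<close> in \<open>C\<close>.\<close>

lemma mp_inv_TT: "mp_inv TT y = Some (L (W y))"
proof -
  have ran: "ran TT = C"
    using TT_iff by (auto simp: ran_def) (metis L_in_C oproj_ident[OF C])
  have "kernel_op TT = N"
    by (auto simp: kernel_op_def[of TT] TT_iff csubspace_zero[OF C(1)] W.zero L.zero Q_eq_0[symmetric]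
        simp del: map_comp_Some_iff)
  then have coim: "coimage_dom TT = dom TT \<inter> C" by (simp add: coimage_dom_def)
  have TT_LW: "TT (L (W y)) = Some (Q y)"
    by (simp add: TT_iff oproj_in[OF C] W_Q oproj_ident[OF C L_in_C] del: map_comp_Some_iff)
  have ex: "\<exists>y1 y2. y1 \<in> ran TT \<and> y2 \<in> orth (ran TT) \<and> y = y1 + y2"
    unfolding ran using oproj_in[OF C, of y] oproj_diff[OF C, of y]
    by (intro exI[of _ "Q y"] exI[of _ "y - Q y"]) simp
  have "(THE x. x \<in> coimage_dom TT \<and> (\<exists>y2\<in>orth (ran TT). TT x = Some (y - y2))) = L (W y)"
    unfolding coim ran
  proof (rule the_equality)
    show "L (W y) \<in> dom TT \<inter> C \<and> (\<exists>y2\<in>orth C. TT (L (W y)) = Some (y - y2))"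
      using TT_LW L_in_C oproj_diff[OF C, of y] by (auto intro!: bexI[of _ "y - Q y"] simp del: map_comp_Some_iff)
  next
    fix x assume x: "x \<in> dom TT \<inter> C \<and> (\<exists>y2\<in>orth C. TT x = Some (y - y2))"
    then obtain y2 where y2: "y2 \<in> orth C" "TT x = Some (y - y2)" by blast
    then have "y - y2 \<in> C" "L (W (y - y2)) = Q x" by (simp_all only: TT_iff)
    moreover from this(1) have "Q y = y - y2"
      using y2 by (intro oproj_unique[OF C]) simp_all
    ultimately show "x = L (W y)"
      using x W_Q[of y] oproj_ident[OF C] by simp
  qed
  then show ?thesis using ex by (simp add: mp_inv_def)
qed

lemma cdual_T: "cdual T = (\<lambda>x. Some (W x))"
  by (rule ext) (simp add: cdual_def map_comp_def mp_inv_TT[unfolded map_comp_def] T_L_W)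

text \<open>The complement of the range of a symmetric operator is its kernel, here
  \<open>N\<close>. This gives the modulus of \<open>W\<close> the initial space already belonging
  to \<open>T\<close>.\<close>

lemma closure_ran_R: "closure (range R) = C"
proof -
  have "csubspace (range R)"
    using csubspace_ran[OF bounded_op_lin[OF hsymmetric_clinear[OF R_sym]]]
    by (simp add: bounded_op_ran)
  moreover have "orth (range R) = N"
  proof
    show "orth (range R) \<subseteq> N"
    proof
      fix w assume "w \<in> orth (range R)"
      then have "hinner (R (R w)) w = 0" by (simp add: orth_def)
      then have "hinner (R w) (R w) = 0" using hsymmetricD[OF R_sym, of "R w" w] by simp
      then have "R w = 0" by simp
      then show "w \<in> N" by (rule kernel_R)
    qed
    show "N \<subseteq> orth (range R)"
      by (auto simp: orth_def hsymmetricD[OF R_sym] R_N)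
  qed
  ultimately show ?thesis using orth_orth_eq_closure by metis
qed

text \<open>A vector \<open>y\<close> orthogonal to \<open>W (L y)\<close> has
  \<open>L y = 0\<close>, hence \<open>P y = 0\<close>. So \<open>W\<close> shares the final space
  of \<open>T\<close>.\<close>

lemma closure_ran_W: "closure (range W) = ran T"
proof -
  have "csubspace (range W)"
    using csubspace_ran[OF bounded_op_lin[OF W_clinear]]
    by (simp add: bounded_op_ran)
  moreover have "orth (range W) = orth (ran T)"
  proof
    show "orth (range W) \<subseteq> orth (ran T)"
    proof
      fix y assume "y \<in> orth (range W)"
      then have "hinner (W (L y)) y = 0" by (simp add: orth_def)
      then have "hinner (L y) (L y) = 0"
        using L_W_adj hinner_eq_0_commute by metis
      then have "P y = 0" using T_L[of y] T_zero by simp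
      then show "y \<in> orth (ran T)" using oproj_diff[OF ran_T, of y] by simp
    qed
    show "orth (ran T) \<subseteq> orth (range W)"
      using W_in_ran by (intro orth_antimono) auto
  qed
  ultimately show ?thesis
    using orth_orth_eq_closure ran_T by (metis closure_closed)
qed

end

lemma (in closed_range_op) ex_closed_range_sqrt: "\<exists>L W R. closed_range_sqrt T L W R"
proof -
  obtain L where L: "clinear L" "bounded_linear L" "\<And>y. L y \<in> C" "\<And>y. T (L y) = Some (P y)"
    by (rule bounded_mp_inverse) blast
  obtain W where W: "clinear W" "bounded_linear W" "\<And>x y. hinner (L y) x = hinner y (W x)"
    using bounded_adjoint[OF L(1,2)] by blast
  obtain K where K: "K > 0" "\<And>y. norm (L y) \<le> norm y * K"
    using bounded_linear.pos_bounded[OF L(2)] by blast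
  have quad: "hinner x (L (W x)) = hinner (W x) (W x)" for x
    by (metis W(3) hinner_commute)
  \<comment> \<open>With \<open>K\<close> bounding \<open>L\<close>, the left side is at most
    \<open>K\<^sup>2\<close> times the squared norm of \<open>W x\<close>, which is the quadratic
    form at \<open>x\<close>.\<close>
  have "(norm (L (W x)))\<^sup>2 \<le> K\<^sup>2 * Re (hinner x (L (W x)))" for x
    using power_mono[OF K(2)[of "W x"], of 2] K(1)
    by (simp add: quad power_mult_distrib hinner_self_norm mult.commute)
  moreover have "hsymmetric (\<lambda>x. L (W x))"
    unfolding hsymmetric_def by (metis W(3) hinner_commute)
  moreover have "bounded_linear (\<lambda>x. L (W x))"
    using bounded_linear_compose[OF L(2) W(2)] .
  ultimately obtain R where R: "hsymmetric R" "hpositive R" "\<And>x. R (R x) = L (W x)"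
    "\<And>f. hsymmetric f \<Longrightarrow> hpositive f \<Longrightarrow> (\<And>x. f (f x) = L (W x)) \<Longrightarrow> f = R"
    using bounded_positive_sqrt[of "\<lambda>x. L (W x)" "K\<^sup>2"] K(1) by (metis zero_less_power)
  have "closed_range_sqrt T L W R"
    by (intro closed_range_sqrt.intro closed_range_op_axioms closed_range_sqrt_axioms.intro)
      (fact L W R)+
  then show ?thesis by blast
qed

section \<open>Partial isometries, closures and the polar decomposition\<close>

lemma partial_isometry_bounded:
  assumes U: "partial_isometry U M N" and M: "csubspace M" "closed M"
  obtains V where "U = (\<lambda>x. Some (V x))" "clinear V" "bounded_linear V" "\<And>x. V (oproj M x) = V x"
proof -
  define V where "V x = the (U x)" for x
  have "dom U = UNIV" using U by (simp add: partial_isometry_def)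
  then have UV: "U x = Some (V x)" for x
    by (metis UNIV_I V_def domD option.sel)
  then have U_eq: "U = (\<lambda>x. Some (V x))" by auto
  have lin: "clinear V"
    using U UV by (auto simp: partial_isometry_def lin_op_def clinear_def)
  interpret V: linear V using lin by (rule clinear_imp_linear)
  have proj: "V (oproj M x) = V x" for x
  proof -
    have "U (x - oproj M x) = Some 0"
      using U oproj_diff[OF M, of x] by (simp add: partial_isometry_def)
    then show ?thesis by (simp add: UV V.diff)
  qed
  have "norm (V x) \<le> norm x * 1" for x
  proof -
    have "norm (V (oproj M x)) = norm (oproj M x)"
      using U oproj_in[OF M, of x] by (simp add: partial_isometry_def V_def)
    then show ?thesis using norm_oproj_le[OF M, of x] by (simp add: proj)
  qed
  then have "bounded_linear V"
    using lin by (intro bounded_linear_intro[of V 1]) (auto simp: V.add V.scale)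
  then show ?thesis using that U_eq lin proj by blast
qed

text \<open>The graph of \<open>V\<close> is closed, and by continuity the graph of a densely
  defined restriction is dense in it.\<close>

lemma op_closure_dense_restriction:
  assumes V: "clinear V" "bounded_linear V"
    and A: "lin_op A" "densely_defined A" "\<And>x u. A x = Some u \<Longrightarrow> u = V x"
  shows "closable A" "op_closure A = (\<lambda>x. Some (V x))"
proof -
  have sub: "closure (op_graph A) \<subseteq> op_graph (\<lambda>x. Some (V x))"
    using bounded_op_closed[OF V] A(3)
    by (intro closure_minimal) (auto simp: op_graph_def closed_op_def)
  have "(x, V x) \<in> closure (op_graph A)" for x
  proof -
    have "x \<in> closure (dom A)" using A(2) by (simp add: densely_defined_def)
    then obtain u where u: "\<And>n. u n \<in> dom A" "u \<longlonglongrightarrow> x"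
      by (meson closure_sequential)
    have "(\<lambda>n. (u n, V (u n))) \<longlonglongrightarrow> (x, V x)"
      using u(2) by (intro tendsto_Pair bounded_linear.tendsto[OF V(2)])
    moreover have "(u n, V (u n)) \<in> op_graph A" for n
      using u(1)[of n] A(3) by (auto simp: op_graph_def)
    ultimately show ?thesis
      unfolding closure_sequential by (intro exI[of _ "\<lambda>n. (u n, V (u n))"]) simp
  qed
  then have iff: "(x, y) \<in> closure (op_graph A) \<longleftrightarrow> y = V x" for x y
    using sub by (auto simp: op_graph_def)
  show "closable A" using A(1) by (simp add: closable_def iff)
  show "op_closure A = (\<lambda>x. Some (V x))" by (simp add: op_closure_def iff)
qed

theorem theorem2p10:
  fixes T U :: "('a::chilbert, 'b::chilbert) op"
  assumes "lin_op T" and "densely_defined T" and "closed_op T" and "closed (ran T)"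
    and "polar_decomp U T"
  shows "closable (cdual T \<circ>\<^sub>m op_abs T) \<and> U = op_closure (cdual T \<circ>\<^sub>m op_abs T)
         \<and> polar_decomp U (cdual T)"
proof -
  interpret closed_range_op T using assms by unfold_locales
  obtain L W R where "closed_range_sqrt T L W R" using ex_closed_range_sqrt by blast
  then interpret closed_range_sqrt T L W R .
  have "closure (ran (op_abs T)) = C" "closure (ran T) = ran T"
    using C ran_T by (simp_all add: op_abs_T ran_S)
  then have U: "partial_isometry U C (ran T)" and T_eq: "T = U \<circ>\<^sub>m S"
    using assms(5) by (auto simp: polar_decomp_def op_abs_T)
  obtain V where V: "U = (\<lambda>x. Some (V x))" "clinear V" "bounded_linear V" "\<And>x. V (Q x) = V x"
    using partial_isometry_bounded[OF U C] by blast
  have W_eq: "W z = V (R z)" for z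
  proof -
    \<comment> \<open>\<open>T = U \<circ>\<^sub>m S\<close> is evaluated at \<open>L (W z)\<close>,
      where \<open>T\<close> takes the value \<open>W z\<close> and \<open>S\<close> the value
      \<open>R z\<close>.\<close>
    have "S (L (W z)) = Some (R z)" using S_R[OF R_in_C] by (simp add: R_R)
    then have "T (L (W z)) = Some (V (R z))" by (subst T_eq) (simp add: V(1))
    then show ?thesis by (simp add: T_L_W)
  qed
  have comp: "(cdual T \<circ>\<^sub>m op_abs T) x = Some u \<longleftrightarrow> (\<exists>z. S x = Some z \<and> u = W z)" for x u
    by (auto simp: cdual_T op_abs_T map_comp_Some_iff)
  have "lin_op (cdual T \<circ>\<^sub>m op_abs T)"
    by (rule lin_opI; unfold comp)
      (use lin_op_zero[OF lin_S] lin_op_add[OF lin_S] lin_op_hscale[OF lin_S] in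
        \<open>fastforce simp: linear_0[OF clinear_imp_linear[OF W_clinear]] clinear_add[OF W_clinear]
          clinear_hscale[OF W_clinear]\<close>)+
  moreover have "dom (cdual T \<circ>\<^sub>m op_abs T) = dom S"
    by (auto simp: dom_def comp)
  then have "densely_defined (cdual T \<circ>\<^sub>m op_abs T)"
    using dense_S by (simp add: densely_defined_def)
  \<comment> \<open>For \<open>S x = Some z\<close> the value is
    \<open>W z = V (R z) = V (Q x) = V x\<close>.\<close>
  moreover have "u = V x" if "(cdual T \<circ>\<^sub>m op_abs T) x = Some u" for x u
    using that V(4) unfolding comp by (auto simp: S_iff W_eq)
  ultimately have "closable (cdual T \<circ>\<^sub>m op_abs T)" "op_closure (cdual T \<circ>\<^sub>m op_abs T) = U"
    using op_closure_dense_restriction[OF V(2,3)] V(1) by blast+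
  moreover have "(\<lambda>x. Some (W x)) = U \<circ>\<^sub>m (\<lambda>x. Some (R x))"
    by (simp add: map_comp_def V(1) W_eq)
  then have "polar_decomp U (cdual T)"
    unfolding polar_decomp_def cdual_T op_abs_W bounded_op_ran closure_ran_R closure_ran_W
    using U bounded_op_lin[OF W_clinear] bounded_op_closed[OF W_clinear W_bounded] bounded_op_dense
    by blast
  ultimately show ?thesis by simp
qed

end
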